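(* There exists a constant $\mathcal{C}>0$ such that the following holds. Let $u_0\in H^2(\mathbb{S}^1)$ with $u_0>0$ on $\mathbb{S}^1$, denote $$\langle u_0\rangle=\frac{1}{2\pi}\int_{\mathbb{S}^1}u_0(x)\,dx,$$ and suppose that $$\frac{\|u_0-\langle u_0\rangle\|_{A^1}}{\langle u_0\rangle}\le\mathcal{C}.$$ Then the unique positive solution $u$, continuous in time with values in $H^2(\mathbb{S}^1)$, of $$\partial_t u+\partial_x\arctan\left(\frac{Hu}{u}\right)=0,\qquad u(x,0)=u_0(x),\qquad x\in\mathbb{S}^1,$$ is global (it exists for all $t\ge0$), and it satisfies $$\|u(t)-\langle u_0\rangle\|_{A^1}\le\|u_0-\langle u_0\rangle\|_{A^1}\,e^{-\delta t}\qquad\text{for all } t\ge 0,$$ for a certain small enough $\delta=\delta(\langle u_0\rangle)>0$.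
   Context: $\mathbb{S}^1$ is the circle $\mathbb{R}/2\pi\mathbb{Z}$, and functions on it are real-valued and $2\pi$-periodic. $H$ is the periodic Hilbert transform in the space variable, $$Hu(x)=\frac{1}{2\pi}\,\mathrm{p.v.}\!\int_{\mathbb{S}^1}\frac{u(y)}{\tan\left(\frac{x-y}{2}\right)}\,dy,$$ where p.v. denotes principal value. Write $u(x)=\sum_{n\in\mathbb{Z}}\hat u(n)e^{inx}$ and let $\Lambda=H\partial_x$, i.e. the Fourier multiplier with symbol $|n|$. The space $H^s(\mathbb{S}^1)$ consists of the functions $u$ with $\sum_{n}|n|^{2s}|\hat u(n)|^2<\infty$, and $\|u\|_{H^s}=\|\Lambda^s u\|_{L^2}$. The Wiener space $A^s(\mathbb{S}^1)$ consists of the functions $u$ with $\sum_{n}|n|^{s}|\hat u(n)|<\infty$, and $\|u\|_{A^s}=\|\widehat{\Lambda^s u}\|_{\ell^1}=\sum_{n}|n|^s|\hat u(n)|$. For every $u_0\in H^2(\mathbb{S}^1)$ with $u_0>0$, the initial value problem in the claim has a unique positive solution $0<u\in C([0,T],H^2(\mathbb{S}^1))$ for some time $T>0$ depending on $\|u_0\|_{H^2}$ and $\min_x u_0(x)$; this is the solution referred to in the claim. *)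

theory Defs
  imports "HOL-Analysis.Analysis"
begin

(* Functions on the circle R/(2 pi Z) are represented as 2 pi-periodic functions on the reals. *)

definition periodic_2pi :: "(real \<Rightarrow> real) \<Rightarrow> bool" where
  "periodic_2pi u \<longleftrightarrow> (\<forall>x. u (x + 2 * pi) = u x)"

definition circle_mean :: "(real \<Rightarrow> real) \<Rightarrow> real" where
  "circle_mean u = (1 / (2 * pi)) * (LINT x:{0..2 * pi}|lborel. u x)"

definition fourier_coeff :: "(real \<Rightarrow> real) \<Rightarrow> int \<Rightarrow> complex" where
  "fourier_coeff u n =
     (1 / (2 * of_real pi)) * (LINT x:{0..2 * pi}|lborel. of_real (u x) * cis (- (of_int n * x)))"

(* The principal value is the limit of the integrals over e \<le> |x - y| \<le> pi as e \<rightarrow> 0+. It exists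
   at every x for continuously differentiable u, in particular for continuous u in H^2. *)
definition hilbert_transform :: "(real \<Rightarrow> real) \<Rightarrow> real \<Rightarrow> real" where
  "hilbert_transform u x =
     (1 / (2 * pi)) *
     Lim (at_right 0)
       (\<lambda>\<epsilon>. LINT y:{y. \<epsilon> \<le> \<bar>x - y\<bar> \<and> \<bar>x - y\<bar> \<le> pi}|lborel. u y / tan ((x - y) / 2))"

(* Only integer orders s are needed. With s :: nat and 0 ^ 0 = 1 the symbol |n| ^ s is that of the
   identity for s = 0, whereas it annihilates the mean for s > 0. *)
definition sobolev :: "nat \<Rightarrow> (real \<Rightarrow> real) set" where
  "sobolev s = {u. periodic_2pi u \<and> set_integrable lborel {0..2 * pi} u \<and>
     (\<lambda>n::int. \<bar>real_of_int n\<bar> ^ (2 * s) * (norm (fourier_coeff u n))\<^sup>2) summable_on UNIV}"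

(* The L^2(0, 2 pi) norm of the function with Fourier coefficients |n| ^ s * fourier_coeff u n,
   by Parseval's identity. For s > 0 it is only a seminorm, as constants have norm 0. *)
definition sobolev_norm :: "nat \<Rightarrow> (real \<Rightarrow> real) \<Rightarrow> real" where
  "sobolev_norm s u =
     sqrt (2 * pi * (\<Sum>\<^sub>\<infinity>n::int. \<bar>real_of_int n\<bar> ^ (2 * s) * (norm (fourier_coeff u n))\<^sup>2))"

(* infsum is 0 on non-summable families. For u in sobolev 2 the sum with s = 1 does converge,
   by the Cauchy-Schwarz inequality. *)
definition wiener_norm :: "nat \<Rightarrow> (real \<Rightarrow> real) \<Rightarrow> real" where
  "wiener_norm s u = (\<Sum>\<^sub>\<infinity>n::int. \<bar>real_of_int n\<bar> ^ s * norm (fourier_coeff u n))"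

(* Continuity in time with values in H^2. The L^2 norm sobolev_norm 0 is included because
   sobolev_norm 2 alone does not see the mean. *)
definition continuous_in_H2 :: "real set \<Rightarrow> (real \<Rightarrow> real \<Rightarrow> real) \<Rightarrow> bool" where
  "continuous_in_H2 I u \<longleftrightarrow>
     (\<forall>t\<in>I. u t \<in> sobolev 2) \<and>
     (\<forall>t\<in>I. ((\<lambda>r. sobolev_norm 0 (\<lambda>x. u r x - u t x)) \<longlongrightarrow> 0) (at t within I) \<and>
            ((\<lambda>r. sobolev_norm 2 (\<lambda>x. u r x - u t x)) \<longlongrightarrow> 0) (at t within I))"

(* u t x is the value at time t and position x. Each u t is the continuous representative of its
   class in H^2. For such u both sides of the equation are continuous functions, so the equation is
   required at every point of I and of the circle (one-sided in t at an endpoint of I);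
   d is the x-derivative of the flux. *)
definition positive_solution ::
    "real set \<Rightarrow> (real \<Rightarrow> real) \<Rightarrow> (real \<Rightarrow> real \<Rightarrow> real) \<Rightarrow> bool" where
  "positive_solution I u0 u \<longleftrightarrow>
     continuous_in_H2 I u \<and>
     (\<forall>t\<in>I. continuous_on UNIV (u t) \<and> (\<forall>x. 0 < u t x)) \<and>
     (\<forall>x. u 0 x = u0 x) \<and>
     (\<forall>t\<in>I. \<forall>x. \<exists>d.
        ((\<lambda>y. arctan (hilbert_transform (u t) y / u t y)) has_real_derivative d) (at x) \<and>
        ((\<lambda>r. u r x) has_real_derivative - d) (at t within I))"

end

theory Submission
  imports Defs
begin

text \<open>
  Let \<open>F\<close> be the holomorphic extension of \<open>u + i Hu\<close> to the unit disc. Since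
  \<open>arctan (Hu / u) = Im (log F)\<close> and \<open>\<partial>\<^sub>x = i z \<partial>\<^sub>z\<close> on the circle, the equation is the boundary real part of
  the complex Burgers equation \<open>F\<^sub>t = - z F' / F\<close>. Writing \<open>F = m H\<close> with \<open>m\<close> the mean and
  \<open>H = 1 + \<Sum>n\<ge>1. h\<^sub>n z\<^sup>n\<close>, it becomes \<open>h\<^sub>n' = - (n h\<^sub>n + R\<^sub>n) / m\<close>, where \<open>R\<^sub>n\<close> involves only \<open>h\<^sub>k\<close> with
  \<open>k < n\<close>. This triangular system is solved by recursion on \<open>n\<close>, and uniqueness holds coefficient by coefficient.
  If \<open>\<Sum>n. n \<bar>h\<^sub>n(0)\<bar>\<close> is small, Duhamel's formula bounds \<open>sup\<^sub>t \<bar>h\<^sub>n(t)\<bar>\<close> by a time-independent majorant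
  that inherits the \<open>A\<^sup>1\<close> and \<open>H\<^sup>2\<close> bounds of the data, so dominated convergence gives continuity in \<open>H\<^sup>2\<close>,
  also at \<open>t = 0\<close>. Finally \<open>\<Sum>n. n \<bar>R\<^sub>n\<bar> \<le> (1 / 2) \<Sum>n. n\<^sup>2 \<bar>h\<^sub>n\<bar>\<close>, so the linear damping wins and the \<open>A\<^sup>1\<close> norm
  decays like \<open>exp (- t / (2 m))\<close>.
\<close>

section \<open>Termwise calculus for series of functions\<close>

text \<open>The coefficient system is solvable for all time whatever the data, but the solution so
  obtained carries no summability at t > 0. All estimates are therefore made on partial sums over
  \<open>{1..<N}\<close> with constants independent of N. Since \<open>conv\<close> at n sees only
  indices below n, these truncations close among themselves, and a finite sum may be absorbed into
  the other side of an inequality. Constants: data of size at most 1/20 have a majorant of at most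
  twice that size, so 1/10 holds at every time. Below 1/10 the nonlinear term costs at most half of
  the damping, which leaves the rate 1/(2m). Decay alone would not do: the limits as t -> 0 and the
  time derivative need one summable bound for all times at once, and the majorant is that bound.
  Uniqueness competes with arbitrary positive solutions, none of them assumed small. Passing from
  the pointwise equation to the coefficient system needs the coefficients of zF'/F to be absolutely
  summable, which is obtained from smallness at the time in question. Smallness in turn comes from
  agreement with the constructed solution, and a first-failure-time argument breaks this
  circle.\<close>

text \<open>Weierstrass's M-test on the derivatives. Derivatives within a convex set serve both
  uses: the space variable on the whole line, and time on \<open>{0..}\<close> with a one-sided
  derivative at 0.\<close>

lemma has_vector_derivative_suminf:
  fixes f :: "nat \<Rightarrow> real \<Rightarrow> 'a::banach"
  assumes "convex S" "x \<in> S"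
    and deriv: "\<And>n y. y \<in> S \<Longrightarrow> (f n has_vector_derivative f' n y) (at y within S)"
    and bound: "\<And>n y. y \<in> S \<Longrightarrow> norm (f' n y) \<le> M n"
    and M: "summable M"
    and sf: "\<And>y. y \<in> S \<Longrightarrow> summable (\<lambda>n. f n y)"
  shows "((\<lambda>y. \<Sum>n. f n y) has_vector_derivative (\<Sum>n. f' n x)) (at x within S)"
proof -
  have ul: "uniform_limit S (\<lambda>n y. \<Sum>i<n. f' i y) (\<lambda>y. \<Sum>i. f' i y) sequentially"
    using bound M by (rule Weierstrass_m_test)
  have "\<exists>g. \<forall>y\<in>S. (\<lambda>n. f n y) sums (g y) \<and>
      (g has_derivative (\<lambda>h. h *\<^sub>R (\<Sum>n. f' n y))) (at y within S)"
  proof (rule has_derivative_series[where f'="\<lambda>n y h. h *\<^sub>R f' n y"])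
    show "(f n has_derivative (\<lambda>h. h *\<^sub>R f' n y)) (at y within S)" if "y \<in> S" for n y
      using deriv[OF that] by (simp add: has_vector_derivative_def)
    show "\<forall>\<^sub>F n in sequentially. \<forall>y\<in>S. \<forall>h. norm ((\<Sum>i<n. h *\<^sub>R f' i y) - h *\<^sub>R (\<Sum>n. f' n y)) \<le> e * norm h"
      if "e > 0" for e
    proof -
      have "\<forall>\<^sub>F n in sequentially. \<forall>y\<in>S. dist (\<Sum>i<n. f' i y) (\<Sum>n. f' n y) < e"
        using ul that by (auto simp: uniform_limit_iff)
      then show ?thesis
      proof eventually_elim
        case (elim n)
        show ?case
        proof (intro ballI allI)
          fix y h assume "y \<in> S"
          have "(\<Sum>i<n. h *\<^sub>R f' i y) - h *\<^sub>R (\<Sum>n. f' n y) = h *\<^sub>R ((\<Sum>i<n. f' i y) - (\<Sum>n. f' n y))"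
            by (simp add: scaleR_sum_right scaleR_diff_right)
          then have "norm ((\<Sum>i<n. h *\<^sub>R f' i y) - h *\<^sub>R (\<Sum>n. f' n y)) =
              \<bar>h\<bar> * dist (\<Sum>i<n. f' i y) (\<Sum>n. f' n y)"
            by (simp add: dist_norm)
          also have "\<dots> \<le> \<bar>h\<bar> * e"
            using elim \<open>y \<in> S\<close> by (intro mult_left_mono) (auto intro: less_imp_le)
          finally show "norm ((\<Sum>i<n. h *\<^sub>R f' i y) - h *\<^sub>R (\<Sum>n. f' n y)) \<le> e * norm h"
            by (simp add: mult.commute)
        qed
      qed
    qed
    show "(\<lambda>n. f n x) sums (\<Sum>n. f n x)"
      using sf[OF \<open>x \<in> S\<close>] by (rule summable_sums)
  qed (use assms in auto)
  then obtain g where g: "\<And>y. y \<in> S \<Longrightarrow> (\<lambda>n. f n y) sums (g y)"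
      "\<And>y. y \<in> S \<Longrightarrow> (g has_derivative (\<lambda>h. h *\<^sub>R (\<Sum>n. f' n y))) (at y within S)"
    by blast
  have "(g has_vector_derivative (\<Sum>n. f' n x)) (at x within S)"
    using g(2)[OF \<open>x \<in> S\<close>] by (simp add: has_vector_derivative_def)
  then show ?thesis
    by (rule has_vector_derivative_transform[OF \<open>x \<in> S\<close>, rotated])
       (use g(1) in \<open>auto simp: sums_iff\<close>)
qed

lemma integral_suminf_dominated:
  fixes f :: "nat \<Rightarrow> real \<Rightarrow> 'a::banach"
  assumes cont: "\<And>n. continuous_on {a..b} (f n)"
    and bound: "\<And>n y. y \<in> {a..b} \<Longrightarrow> norm (f n y) \<le> M n" and M: "summable M"
  shows "(\<lambda>n. integral {a..b} (f n)) sums integral {a..b} (\<lambda>x. \<Sum>n. f n x)"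
proof -
  have ul: "uniform_limit {a..b} (\<lambda>n y. \<Sum>i<n. f i y) (\<lambda>y. \<Sum>i. f i y) sequentially"
    using bound M by (rule Weierstrass_m_test)
  obtain I J where IJ: "\<And>n. ((\<lambda>y. \<Sum>i<n. f i y) has_integral I n) {a..b}"
      "((\<lambda>y. \<Sum>i. f i y) has_integral J) {a..b}" "I \<longlonglongrightarrow> J"
    using uniform_limit_integral[OF ul] cont by (metis continuous_on_sum trivial_limit_sequentially)
  have "I n = (\<Sum>i<n. integral {a..b} (f i))" for n
    using integral_unique[OF IJ(1)[of n]] integral_sum[of "{..<n}" f "{a..b}"] integrable_continuous_interval[OF cont]
    by simp
  then have "I = (\<lambda>n. \<Sum>i<n. integral {a..b} (f i))"
    by (rule ext)
  then show ?thesis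
    using IJ(2,3) by (simp add: sums_def integral_unique)
qed

lemma continuous_on_suminf_dominated:
  fixes f :: "nat \<Rightarrow> 'b::topological_space \<Rightarrow> 'a::banach"
  assumes cont: "\<And>n. continuous_on S (f n)"
    and bound: "\<And>n y. y \<in> S \<Longrightarrow> norm (f n y) \<le> M n" and M: "summable M"
  shows "continuous_on S (\<lambda>x. \<Sum>n. f n x)"
proof -
  have ul: "uniform_limit S (\<lambda>n y. \<Sum>i<n. f i y) (\<lambda>y. \<Sum>i. f i y) sequentially"
    using bound M by (rule Weierstrass_m_test)
  show ?thesis
    by (rule uniform_limit_theorem[OF _ ul]) (auto intro!: always_eventually continuous_on_sum cont)
qed

section \<open>One-sided trigonometric series\<close>

definition trig :: "(nat \<Rightarrow> complex) \<Rightarrow> real \<Rightarrow> complex" where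
  "trig a x = (\<Sum>n. a n * cis (real n * x))"

lemma summable_trig:
  assumes "summable (\<lambda>n. norm (a n))"
  shows "summable (\<lambda>n. a n * cis (real n * x))" "summable (\<lambda>n. norm (a n * cis (real n * x)))"
proof -
  show "summable (\<lambda>n. norm (a n * cis (real n * x)))"
    using assms by (simp add: norm_mult)
  then show "summable (\<lambda>n. a n * cis (real n * x))"
    by (rule summable_norm_cancel)
qed

lemma continuous_on_trig:
  assumes "summable (\<lambda>n. norm (a n))"
  shows "continuous_on S (trig a)"
  unfolding trig_def
  by (rule continuous_on_suminf_dominated[where M="\<lambda>n. norm (a n)"])
     (auto intro!: continuous_intros assms simp: norm_mult)

lemma norm_trig_le:
  assumes "summable (\<lambda>n. norm (a n))"
  shows "norm (trig a x) \<le> (\<Sum>n. norm (a n))"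
  unfolding trig_def using summable_norm[OF summable_trig(2)[OF assms, of x]]
  by (simp add: norm_mult)

lemma trig_diff:
  assumes "summable (\<lambda>n. norm (a n))" "summable (\<lambda>n. norm (b n))"
  shows "trig a x - trig b x = trig (\<lambda>n. a n - b n) x"
  unfolding trig_def using suminf_diff[OF summable_trig(1)[OF assms(1)] summable_trig(1)[OF assms(2)]]
  by (simp add: algebra_simps)

lemma trig_cmult:
  assumes "summable (\<lambda>n. norm (a n))"
  shows "trig (\<lambda>n. c * a n) x = c * trig a x"
  unfolding trig_def using suminf_mult[OF summable_trig(1)[OF assms, of x], of c]
  by (simp add: mult.assoc)

lemma trig_periodic: "trig a (x + 2 * pi) = trig a x"
proof -
  have "cis (real n * (x + 2 * pi)) = cis (real n * x)" for n
    by (simp add: distrib_left cis_mult [symmetric] mult.assoc [symmetric])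
       (metis cis_multiple_2pi Ints_of_nat mult.commute mult.left_commute mult.right_neutral)
  then show ?thesis
    by (simp add: trig_def)
qed

lemma summable_norm_of_weighted:
  assumes "summable (\<lambda>n. real n * norm (a n :: complex))"
  shows "summable (\<lambda>n. norm (a n))"
proof (rule summable_comparison_test_ev[OF _ assms])
  show "\<forall>\<^sub>F n in sequentially. norm (norm (a n)) \<le> real n * norm (a n)"
    using eventually_ge_at_top[of 1]
  proof eventually_elim
    case (elim n)
    then show ?case using mult_right_mono[of 1 "real n" "norm (a n)"] by simp
  qed
qed

lemma cis_has_vector_derivative:
  "((\<lambda>x. c * cis (k * x)) has_vector_derivative (c * (\<i> * of_real k * cis (k * x)))) (at x within S)"
  unfolding cis_conv_exp
  by (rule has_vector_derivative_real_field derivative_eq_intros refl | simp)+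

lemma trig_has_vector_derivative:
  assumes "summable (\<lambda>n. real n * norm (a n))"
  shows "(trig a has_vector_derivative \<i> * trig (\<lambda>n. of_nat n * a n) x) (at x)"
proof -
  have s: "summable (\<lambda>n. norm (of_nat n * a n))"
    using assms by (simp add: norm_mult)
  have "((\<lambda>x. \<Sum>n. a n * cis (real n * x)) has_vector_derivative
      (\<Sum>n. a n * (\<i> * of_real (real n) * cis (real n * x)))) (at x within UNIV)"
    by (rule has_vector_derivative_suminf[where M="\<lambda>n. real n * norm (a n)"])
       (auto intro!: has_vector_derivative_eq_rhs[OF cis_has_vector_derivative] assms summable_trig
             summable_norm_of_weighted simp: norm_mult)
  moreover have "(\<Sum>n. a n * (\<i> * of_real (real n) * cis (real n * x))) =
      \<i> * trig (\<lambda>n. of_nat n * a n) x"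
    unfolding trig_def using suminf_mult[OF summable_trig(1)[OF s, of x], of \<i>]
    by (simp add: algebra_simps)
  ultimately show ?thesis
    by (simp add: trig_def[abs_def])
qed

section \<open>Fourier coefficients\<close>

lemma integral_cis:
  "integral {0..2 * pi} (\<lambda>x. c * cis (of_int k * x)) = (if k = 0 then c * (2 * of_real pi) else 0)"
proof (cases "k = 0")
  case False
  have "((\<lambda>x. c * cis (of_int k * x)) has_integral
     (c / (\<i> * of_int k)) * cis (of_int k * (2 * pi)) - (c / (\<i> * of_int k)) * cis (of_int k * 0)) {0..2 * pi}"
  proof (rule fundamental_theorem_of_calculus)
    show "((\<lambda>x. c / (\<i> * of_int k) * cis (of_int k * x)) has_vector_derivative c * cis (of_int k * x))
            (at x within {0..2 * pi})" for x
      by (rule has_vector_derivative_eq_rhs[OF cis_has_vector_derivative]) (use False in simp)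
  qed simp
  moreover have "cis (of_int k * (2 * pi)) = 1"
    using cis_multiple_2pi[of "of_int k"] by (simp add: ac_simps)
  ultimately have "((\<lambda>x. c * cis (of_int k * x)) has_integral 0) {0..2 * pi}"
    by simp
  then have "integral {0..2 * pi} (\<lambda>x. c * cis (of_int k * x)) = 0"
    by (rule integral_unique)
  then show ?thesis
    using False by (simp only: if_False)
qed (simp add: mult.commute scaleR_conv_of_real)

lemma fourier_coeff_eq_integral:
  assumes "continuous_on UNIV u"
  shows "fourier_coeff u n =
    (1 / (2 * of_real pi)) * integral {0..2 * pi} (\<lambda>x. of_real (u x) * cis (- (of_int n * x)))"
proof -
  have "continuous_on {0..2 * pi} u"
    using assms continuous_on_subset by blast
  then have "continuous_on {0..2 * pi} (\<lambda>x. of_real (u x) * cis (- (of_int n * x)))"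
    by (intro continuous_intros)
  then have "set_integrable lborel {0..2 * pi} (\<lambda>x. of_real (u x) * cis (- (of_int n * x)))"
    by (rule borel_integrable_atLeastAtMost')
  then show ?thesis
    by (simp add: fourier_coeff_def set_borel_integral_eq_integral)
qed

text \<open>Writing Re z = (z + cnj z)/2 splits the k-th term into the frequencies k and -k, so only
  k = |n| survives the integration. For n = 0 both halves contribute, and their sum is the real part
  of \<open>a 0\<close>.\<close>

lemma fourier_coeff_Re_trig:
  assumes a: "summable (\<lambda>n. norm (a n))"
  shows "fourier_coeff (\<lambda>x. Re (trig a x)) n =
    (if n = 0 then of_real (Re (a 0)) else if n > 0 then a (nat n) / 2 else cnj (a (nat (- n))) / 2)"
proof -
  define g where "g = (\<lambda>k x. of_real (Re (a k * cis (real k * x))) * cis (- (of_int n * x)))"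
  define J where "J = (\<lambda>k. (if int k = n then of_real pi * a k else 0) + (if - int k = n then of_real pi * cnj (a k) else 0))"
  have gJ: "integral {0..2 * pi} (g k) = J k" for k
  proof -
    have "g k x = (a k / 2) * cis (of_int (int k - n) * x) + (cnj (a k) / 2) * cis (of_int (- int k - n) * x)" for x
    proof -
      have "g k x = ((a k * cis (real k * x) + cnj (a k * cis (real k * x))) / 2) * cis (- (of_int n * x))"
        unfolding g_def by (subst complex_add_cnj) simp
      also have "\<dots> = (a k / 2) * (cis (real k * x) * cis (- (of_int n * x))) +
          (cnj (a k) / 2) * (cis (- (real k * x)) * cis (- (of_int n * x)))"
        by (simp add: cis_cnj add_divide_distrib algebra_simps)
      finally show ?thesis
        by (simp add: cis_mult left_diff_distrib)
    qed
    then have "g k = (\<lambda>x. (a k / 2) * cis (of_int (int k - n) * x) + (cnj (a k) / 2) * cis (of_int (- int k - n) * x))"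
      by (rule ext)
    then have "integral {0..2 * pi} (g k) = integral {0..2 * pi} (\<lambda>x. (a k / 2) * cis (of_int (int k - n) * x)) +
        integral {0..2 * pi} (\<lambda>x. (cnj (a k) / 2) * cis (of_int (- int k - n) * x))"
      by (subst integral_add [symmetric]) (auto intro!: integrable_continuous_interval continuous_intros)
    then show ?thesis
      unfolding integral_cis J_def by auto
  qed
  have "(\<lambda>k. integral {0..2 * pi} (g k)) sums integral {0..2 * pi} (\<lambda>x. \<Sum>k. g k x)"
  proof (rule integral_suminf_dominated)
    show "continuous_on {0..2 * pi} (g k)" for k
      unfolding g_def by (intro continuous_intros)
    show "norm (g k y) \<le> norm (a k)" for k y
    proof -
      have "norm (g k y) = \<bar>Re (a k * cis (real k * y))\<bar>"
        by (simp only: g_def norm_mult norm_of_real norm_cis mult_1_right)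
      also have "\<dots> \<le> norm (a k)"
        using abs_Re_le_cmod[of "a k * cis (real k * y)"] by (simp only: norm_mult norm_cis mult_1_right)
      finally show ?thesis .
    qed
  qed (rule a)
  moreover have "J sums (if n = 0 then 2 * of_real pi * of_real (Re (a 0)) else if n > 0 then of_real pi * a (nat n) else of_real pi * cnj (a (nat (- n))))"
  proof -
    have "J k = 0" if "k \<noteq> nat \<bar>n\<bar>" for k
      using that by (auto simp: J_def)
    then have "J sums J (nat \<bar>n\<bar>)"
      by (intro sums_If_finite_set[of "{nat \<bar>n\<bar>}" J, simplified, THEN sums_cong[THEN iffD1, rotated]]) auto
    moreover have "a 0 + cnj (a 0) = 2 * of_real (Re (a 0))"
      by (simp add: complex_add_cnj)
    then have "of_real pi * a 0 + of_real pi * cnj (a 0) = 2 * of_real pi * of_real (Re (a 0))"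
      by (metis (no_types, lifting) distrib_left mult.assoc mult.left_commute)
    ultimately show ?thesis
      by (auto simp: J_def)
  qed
  moreover have "(\<Sum>k. g k x) = of_real (Re (trig a x)) * cis (- (of_int n * x))" for x
  proof -
    have "(\<lambda>k. a k * cis (real k * x)) sums trig a x"
      unfolding trig_def by (rule summable_sums[OF summable_trig(1)[OF a]])
    then have "(\<lambda>k. complex_of_real (Re (a k * cis (real k * x)))) sums complex_of_real (Re (trig a x))"
      by (intro sums_of_real sums_Re)
    then show ?thesis
      unfolding g_def by (intro sums_unique[symmetric] sums_mult2)
  qed
  ultimately have "integral {0..2 * pi} (\<lambda>x. of_real (Re (trig a x)) * cis (- (of_int n * x))) =
    (if n = 0 then 2 * of_real pi * of_real (Re (a 0)) else if n > 0 then of_real pi * a (nat n) else of_real pi * cnj (a (nat (- n))))"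
    by (simp add: gJ sums_iff)
  moreover have "continuous_on UNIV (\<lambda>x. Re (trig a x))"
    using continuous_on_trig[OF a] by (intro continuous_intros)
  ultimately show ?thesis
    by (simp add: fourier_coeff_eq_integral)
qed

section \<open>Sobolev and Wiener norms of trigonometric series\<close>

text \<open>The integers split into n >= 0 and n < 0; doubling the first half counts 0 twice, hence
  the correction.\<close>

lemma has_sum_even_int:
  fixes g :: "int \<Rightarrow> real"
  assumes even: "\<And>n. g (- n) = g n" and nonneg: "\<And>n. 0 \<le> g n"
    and S: "summable (\<lambda>n. g (int n))"
  shows "(g has_sum (2 * (\<Sum>n. g (int n)) - g 0)) UNIV"
proof -
  have "((\<lambda>n. g (int n)) has_sum (\<Sum>n. g (int n))) UNIV"
    using S nonneg by (intro sums_nonneg_imp_has_sum summable_sums)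
  then have 1: "(g has_sum (\<Sum>n. g (int n))) (range int)"
    by (subst has_sum_reindex) (auto simp: o_def)
  have "(\<lambda>n. g (int (Suc n))) sums ((\<Sum>n. g (int n)) - g (int 0))"
    using S summable_sums by (subst sums_Suc_iff) simp
  then have "((\<lambda>n. g (- int (Suc n))) has_sum ((\<Sum>n. g (int n)) - g 0)) UNIV"
    unfolding even using nonneg by (intro sums_nonneg_imp_has_sum) simp_all
  then have 2: "(g has_sum ((\<Sum>n. g (int n)) - g 0)) (range (\<lambda>n. - int (Suc n)))"
    by (subst has_sum_reindex) (auto simp: o_def inj_on_def)
  have "range int \<union> range (\<lambda>n. - int (Suc n)) = UNIV"
  proof -
    have "n \<in> range int \<union> range (\<lambda>n. - int (Suc n))" for n
      by (cases n) auto
    then show ?thesis by blast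
  qed
  moreover have "range int \<inter> range (\<lambda>n. - int (Suc n)) = {}"
    by auto
  ultimately show ?thesis
    using has_sum_Un_disjoint[OF 1 2] by simp
qed

lemma norm_fourier_coeff_Re_trig:
  assumes "summable (\<lambda>n. norm (a n))"
  shows "norm (fourier_coeff (\<lambda>x. Re (trig a x)) n) =
    (if n = 0 then \<bar>Re (a 0)\<bar> else norm (a (nat \<bar>n\<bar>)) / 2)"
  using assms by (auto simp: fourier_coeff_Re_trig norm_divide)

lemma wiener_norm_Re_trig:
  assumes "summable (\<lambda>n. real n * norm (a n))"
  shows "wiener_norm 1 (\<lambda>x. Re (trig a x)) = (\<Sum>n. real n * norm (a n))"
proof -
  note s = summable_norm_of_weighted[OF assms]
  define g where "g = (\<lambda>n::int. \<bar>real_of_int n\<bar> ^ 1 * norm (fourier_coeff (\<lambda>x. Re (trig a x)) n))"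
  have g: "g (int n) = (real n * norm (a n)) / 2" for n
    by (simp add: g_def norm_fourier_coeff_Re_trig[OF s])
  have "(g has_sum (2 * (\<Sum>n. g (int n)) - g 0)) UNIV"
  proof (rule has_sum_even_int)
    show "summable (\<lambda>n. g (int n))"
      unfolding g using assms by (rule summable_divide)
  qed (auto simp: g_def norm_fourier_coeff_Re_trig[OF s])
  moreover have "(\<Sum>n. g (int n)) = (\<Sum>n. real n * norm (a n)) / 2"
    unfolding g using assms by (rule suminf_divide)
  ultimately show ?thesis
    using g[of 0] by (simp add: wiener_norm_def g_def infsumI)
qed

text \<open>The embedding of H^2 into A^1: Cauchy-Schwarz for n|a_n| = (1/n)(n^2|a_n|). At n = 0 the
  convention 1/0 = 0 makes the factorisation hold and keeps the first series the usual one over n >=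
  1.\<close>

lemma Cauchy_Schwarz_weighted:
  fixes a :: "nat \<Rightarrow> complex"
  assumes "summable (\<lambda>n. real n ^ 4 * (norm (a n))\<^sup>2)"
  shows "summable (\<lambda>n. real n * norm (a n))"
    and "(\<Sum>n. real n * norm (a n)) \<le>
      sqrt (\<Sum>n. (1 / real n)\<^sup>2) * sqrt (\<Sum>n. real n ^ 4 * (norm (a n))\<^sup>2)"
proof -
  have s2: "summable (\<lambda>n. (1 / real n)\<^sup>2)"
    using inverse_power_summable[of 2, where ?'a=real] by (simp add: power_one_over inverse_eq_divide)
  have b: "(\<Sum>n<N. real n * norm (a n)) \<le>
      sqrt (\<Sum>n. (1 / real n)\<^sup>2) * sqrt (\<Sum>n. real n ^ 4 * (norm (a n))\<^sup>2)" for N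
  proof -
    have "(\<Sum>n<N. real n * norm (a n)) = (\<Sum>n<N. \<bar>1 / real n\<bar> * \<bar>real n ^ 2 * norm (a n)\<bar>)"
      by (intro sum.cong) (auto simp: power2_eq_square)
    also have "\<dots> \<le> L2_set (\<lambda>n. 1 / real n) {..<N} * L2_set (\<lambda>n. real n ^ 2 * norm (a n)) {..<N}"
      by (rule L2_set_mult_ineq)
    also have "\<dots> \<le> sqrt (\<Sum>n. (1 / real n)\<^sup>2) * sqrt (\<Sum>n. real n ^ 4 * (norm (a n))\<^sup>2)"
      unfolding L2_set_def using assms s2
      by (intro mult_mono real_sqrt_le_mono)
         (auto intro!: sum_le_suminf sum_nonneg suminf_nonneg simp: power_mult_distrib)
    finally show ?thesis .
  qed
  show "summable (\<lambda>n. real n * norm (a n))"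
    using b by (intro summableI_nonneg_bounded) auto
  then show "(\<Sum>n. real n * norm (a n)) \<le>
      sqrt (\<Sum>n. (1 / real n)\<^sup>2) * sqrt (\<Sum>n. real n ^ 4 * (norm (a n))\<^sup>2)"
    using b by (intro suminf_le_const)
qed

text \<open>The factor is 2 pi * 2 * (1/4) = pi: two frequencies n and -n, each with a coefficient
  of modulus |a_n|/2.\<close>

lemma Re_trig_sobolev:
  assumes "summable (\<lambda>n. real n ^ 4 * (norm (a n))\<^sup>2)"
  shows "(\<lambda>x. Re (trig a x)) \<in> sobolev 2"
    and "sobolev_norm 2 (\<lambda>x. Re (trig a x)) = sqrt (pi * (\<Sum>n. real n ^ 4 * (norm (a n))\<^sup>2))"
proof -
  note s = summable_norm_of_weighted[OF Cauchy_Schwarz_weighted(1)[OF assms]]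
  define g where "g = (\<lambda>n::int. \<bar>real_of_int n\<bar> ^ (2 * 2) * (norm (fourier_coeff (\<lambda>x. Re (trig a x)) n))\<^sup>2)"
  have g: "g (int n) = (real n ^ 4 * (norm (a n))\<^sup>2) / 4" for n
    by (simp add: g_def norm_fourier_coeff_Re_trig[OF s] power2_eq_square)
  have hs: "(g has_sum (2 * (\<Sum>n. g (int n)) - g 0)) UNIV"
  proof (rule has_sum_even_int)
    show "summable (\<lambda>n. g (int n))"
      unfolding g using assms by (rule summable_divide)
  qed (auto simp: g_def norm_fourier_coeff_Re_trig[OF s])
  moreover have "(\<Sum>n. g (int n)) = (\<Sum>n. real n ^ 4 * (norm (a n))\<^sup>2) / 4"
    unfolding g using assms by (rule suminf_divide)
  ultimately show "sobolev_norm 2 (\<lambda>x. Re (trig a x)) = sqrt (pi * (\<Sum>n. real n ^ 4 * (norm (a n))\<^sup>2))"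
    using g[of 0] unfolding sobolev_norm_def g_def[symmetric] by (simp add: infsumI)
  have "continuous_on {0..2 * pi} (\<lambda>x. Re (trig a x))"
    using continuous_on_trig[OF s] by (intro continuous_intros)
  then show "(\<lambda>x. Re (trig a x)) \<in> sobolev 2"
    using hs borel_integrable_atLeastAtMost'
    by (auto simp: sobolev_def periodic_2pi_def trig_periodic g_def summable_on_def)
qed

text \<open>With weight 0 ^ 0 = 1 the mean does count, and with factor 1 instead of 1/4. This is why
  the index 0 is split off here but not for the H^2 seminorm.\<close>

lemma sobolev_norm_0_Re_trig:
  assumes "summable (\<lambda>n. real n ^ 4 * (norm (a n))\<^sup>2)"
  shows "summable (\<lambda>n. (norm (a (Suc n)))\<^sup>2)"
    and "sobolev_norm 0 (\<lambda>x. Re (trig a x)) =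
      sqrt (2 * pi * ((Re (a 0))\<^sup>2 + (\<Sum>n. (norm (a (Suc n)))\<^sup>2) / 2))"
proof -
  note s = summable_norm_of_weighted[OF Cauchy_Schwarz_weighted(1)[OF assms]]
  define g where "g = (\<lambda>n::int. \<bar>real_of_int n\<bar> ^ (2 * 0) * (norm (fourier_coeff (\<lambda>x. Re (trig a x)) n))\<^sup>2)"
  have g: "g (int (Suc n)) = (norm (a (Suc n)))\<^sup>2 / 4" for n
    by (simp add: g_def norm_fourier_coeff_Re_trig[OF s] power2_eq_square nat_add_distrib)
  have g0: "g 0 = (Re (a 0))\<^sup>2"
    by (simp add: g_def norm_fourier_coeff_Re_trig[OF s])
  show s2: "summable (\<lambda>n. (norm (a (Suc n)))\<^sup>2)"
  proof (rule summable_comparison_test')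
    show "summable (\<lambda>n. real (Suc n) ^ 4 * (norm (a (Suc n)))\<^sup>2)"
      using assms by (subst summable_Suc_iff)
    show "norm ((norm (a (Suc n)))\<^sup>2) \<le> real (Suc n) ^ 4 * (norm (a (Suc n)))\<^sup>2" for n
      using mult_right_mono[of 1 "real (Suc n) ^ 4" "(norm (a (Suc n)))\<^sup>2"] one_le_power[of "real (Suc n)" 4] by simp
  qed
  then have "summable (\<lambda>n. g (int (Suc n)))"
    unfolding g by (rule summable_divide)
  then have gs: "summable (\<lambda>n. g (int n))"
    by (subst (asm) summable_Suc_iff)
  then have hs: "(g has_sum (2 * (\<Sum>n. g (int n)) - g 0)) UNIV"
    by (rule has_sum_even_int[rotated 2]) (auto simp: g_def norm_fourier_coeff_Re_trig[OF s])
  have "(\<Sum>n. g (int (Suc n))) = (\<Sum>n. (norm (a (Suc n)))\<^sup>2) / 4"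
    unfolding g using s2 by (rule suminf_divide)
  moreover have "(\<Sum>n. g (int (Suc n))) = (\<Sum>n. g (int n)) - g (int 0)"
    by (rule suminf_split_head[OF gs])
  ultimately have "2 * (\<Sum>n. g (int n)) - g 0 = g 0 + (\<Sum>n. (norm (a (Suc n)))\<^sup>2) / 2"
    by (simp del: of_nat_Suc)
  with hs have "(g has_sum (g 0 + (\<Sum>n. (norm (a (Suc n)))\<^sup>2) / 2)) UNIV"
    by (simp only:)
  then show "sobolev_norm 0 (\<lambda>x. Re (trig a x)) =
      sqrt (2 * pi * ((Re (a 0))\<^sup>2 + (\<Sum>n. (norm (a (Suc n)))\<^sup>2) / 2))"
    unfolding sobolev_norm_def g_def[symmetric] by (simp add: infsumI g0)
qed

section \<open>Uniqueness of Fourier coefficients\<close>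

lemma continuous_on_real_polynomial_cis:
  assumes "real_polynomial_function (g :: complex \<Rightarrow> real)"
  shows "continuous_on S (\<lambda>x. g (cis x))"
proof -
  have "continuous_on UNIV g"
    using assms continuous_real_polymonial_function by (intro continuous_at_imp_continuous_on) blast
  then show ?thesis
    by (rule continuous_on_compose2) (auto intro: continuous_intros)
qed

text \<open>On the circle a real-linear function is a combination of e^{ix} and e^{-ix}, so
  multiplying by it only shifts frequencies. \<open>W\<close> is complex and universally quantified
  in the induction so that products can be treated one factor at a time.\<close>

lemma real_polynomial_preserves_vanishing_coefficients:
  fixes g :: "complex \<Rightarrow> real"
  assumes "real_polynomial_function g" "continuous_on {0..2 * pi} W"
    and "\<And>n::int. integral {0..2 * pi} (\<lambda>x. W x * cis (of_int n * x)) = 0"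
  shows "integral {0..2 * pi} (\<lambda>x. W x * of_real (g (cis x)) * cis (of_int n * x)) = 0"
  using assms
proof (induction arbitrary: W n rule: real_polynomial_function.induct)
  case (linear f)
  define p q where "p = f 1" and "q = f \<i>"
  have f: "f (cis x) = cos x * p + sin x * q" for x
  proof -
    have "cis x = cos x *\<^sub>R 1 + sin x *\<^sub>R \<i>"
      by (simp add: complex_eq_iff)
    then show ?thesis
      using linear(1) by (simp add: p_def q_def bounded_linear.linear linear_add linear_cmul)
  qed
  have "W x * of_real (f (cis x)) * cis (of_int n * x) =
      (of_real p - \<i> * of_real q) / 2 * (W x * cis (of_int (n + 1) * x)) + (of_real p + \<i> * of_real q) / 2 * (W x * cis (of_int (n - 1) * x))" for x
  proof -
    have "complex_of_real (f (cis x)) = (of_real p - \<i> * of_real q) / 2 * cis x + (of_real p + \<i> * of_real q) / 2 * cis (- x)"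
      by (simp add: f complex_eq_iff field_simps)
    moreover have "cis (of_int (n + 1) * x) = cis x * cis (of_int n * x)" "cis (of_int (n - 1) * x) = cis (- x) * cis (of_int n * x)"
      by (simp_all add: cis_mult algebra_simps)
    ultimately show ?thesis
      by (simp add: algebra_simps)
  qed
  then have "integral {0..2 * pi} (\<lambda>x. W x * of_real (f (cis x)) * cis (of_int n * x)) =
      integral {0..2 * pi} (\<lambda>x. (of_real p - \<i> * of_real q) / 2 * (W x * cis (of_int (n + 1) * x))) +
      integral {0..2 * pi} (\<lambda>x. (of_real p + \<i> * of_real q) / 2 * (W x * cis (of_int (n - 1) * x)))"
    by (simp only:) (intro integral_add integrable_continuous_interval continuous_intros linear(2))
  then show ?case
    by (simp only: integral_mult_right linear(3) mult_zero_right add_0)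
next
  case (const c)
  then show ?case
    using integral_mult_right[of "{0..2 * pi}" "complex_of_real c" "\<lambda>x. W x * cis (of_int n * x)"]
    by (simp add: ac_simps)
next
  case (add f g)
  have c: "continuous_on {0..2 * pi} (\<lambda>x. f (cis x))" "continuous_on {0..2 * pi} (\<lambda>x. g (cis x))"
    using add(1,2) continuous_on_real_polynomial_cis by blast+
  have "integral {0..2 * pi} (\<lambda>x. W x * of_real (f (cis x) + g (cis x)) * cis (of_int n * x)) =
      integral {0..2 * pi} (\<lambda>x. W x * of_real (f (cis x)) * cis (of_int n * x)) +
      integral {0..2 * pi} (\<lambda>x. W x * of_real (g (cis x)) * cis (of_int n * x))"
    by (subst integral_add [symmetric])
       (auto intro!: integrable_continuous_interval continuous_intros add c simp: distrib_left distrib_right)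
  then show ?case
    by (simp only: add.IH add.prems add_0)
next
  case (mult f g)
  have c: "continuous_on {0..2 * pi} (\<lambda>x. f (cis x))"
    using mult(1) by (rule continuous_on_real_polynomial_cis)
  \<comment> \<open>The first factor is absorbed into \<open>W\<close>, whose coefficients still
    vanish by the other induction hypothesis.\<close>
  have "integral {0..2 * pi} (\<lambda>x. (W x * of_real (f (cis x))) * of_real (g (cis x)) * cis (of_int n * x)) = 0"
    by (rule mult.IH(2)) (auto intro!: continuous_intros mult c)
  then show ?case
    by (simp add: mult.assoc)
qed

lemma periodic_2pi_shift:
  assumes "periodic_2pi v"
  shows "v (x + 2 * pi * of_int k) = v x"
proof (induction k rule: int_induct[of _ 0])
  case (step1 i)
  then show ?case
    using assms[unfolded periodic_2pi_def, rule_format, of "x + 2 * pi * of_int i"]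
    by (simp add: algebra_simps)
next
  case (step2 i)
  then show ?case
    using assms[unfolded periodic_2pi_def, rule_format, of "x + 2 * pi * of_int (i - 1)"]
    by (simp add: algebra_simps)
qed simp

lemma periodic_2pi_reduce:
  obtains y k where "y \<in> {0..2 * pi}" "x = y + 2 * pi * of_int k"
proof
  define k where "k = \<lfloor>x / (2 * pi)\<rfloor>"
  have "of_int k \<le> x / (2 * pi)" "x / (2 * pi) \<le> of_int k + 1"
    unfolding k_def by linarith+
  then show "x - 2 * pi * of_int k \<in> {0..2 * pi}"
    by (simp add: field_simps)
  show "x = (x - 2 * pi * of_int k) + 2 * pi * of_int k"
    by simp
qed

text \<open>\<open>Arg\<close> is discontinuous across the negative real axis, \<open>Arg2pi\<close>
  across the positive one. By periodicity both give the same value of \<open>v\<close>, so at each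
  point of the circle a branch continuous there can be used.\<close>

lemma continuous_periodic_on_circle:
  fixes v :: "real \<Rightarrow> real"
  assumes v: "continuous_on UNIV v" "periodic_2pi v"
  obtains f where "continuous_on (sphere (0::complex) 1) f" "\<And>x. f (cis x) = v x"
proof
  define f where "f = (\<lambda>z. v (Arg z))"
  have shift: "v x = v y" if eq: "cis x = cis y" for x y
  proof -
    obtain k where "x = y + 2 * pi * of_int k"
      using arg_cong[OF eq, of Re] arg_cong[OF eq, of Im] sin_cos_eq_iff[of x y] by auto
    then show ?thesis using periodic_2pi_shift[OF v(2)] by simp
  qed
  show fv: "f (cis x) = v x" for x
    unfolding f_def by (rule shift) (simp add: cis_Arg sgn_eq)
  have f2: "f z = v (Arg2pi z)" if "z \<noteq> 0" for z
    unfolding f_def using that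
    by (intro shift) (metis Arg2pi_eq cis_Arg cis_conv_exp sgn_eq nonzero_mult_div_cancel_left norm_eq_zero of_real_eq_0_iff)
  show "continuous_on (sphere 0 1) f"
  proof (rule continuous_at_imp_continuous_on, rule ballI)
    fix z :: complex assume "z \<in> sphere 0 1"
    then have "z \<noteq> 0" by auto
    show "isCont f z"
    proof (cases "z \<in> \<real>\<^sub>\<le>\<^sub>0")
      case False
      then show ?thesis
        unfolding f_def using v(1)
        by (intro isCont_o2[OF continuous_at_Arg]) (auto simp: continuous_on_eq_continuous_at)
    next
      case True
      then have "z \<notin> \<real>\<^sub>\<ge>\<^sub>0"
        using \<open>z \<noteq> 0\<close> by (metis complex_nonneg_Reals_iff complex_nonpos_Reals_iff complex_eqI order_antisym zero_complex.sel)
      then have "isCont (\<lambda>z. v (Arg2pi z)) z"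
        using v(1) by (intro isCont_o2[OF continuous_at_Arg2pi]) (auto simp: continuous_on_eq_continuous_at)
      moreover have "\<forall>\<^sub>F w in nhds z. v (Arg2pi w) = f w"
        using t1_space_nhds[OF \<open>z \<noteq> 0\<close>] by eventually_elim (use f2 in auto)
      ultimately show ?thesis
        by (subst (asm) isCont_cong)
    qed
  qed
qed

text \<open>By Stone-Weierstrass \<open>v\<close> is within e of a polynomial g in the circle
  coordinates. As \<open>v\<close> is orthogonal to g, the integral of v^2 equals that of v(v - g),
  hence is at most e times the integral of |v|.\<close>

lemma vanishing_fourier_coeff:
  fixes v :: "real \<Rightarrow> real"
  assumes v: "continuous_on UNIV v" "periodic_2pi v" and zero: "\<And>n. fourier_coeff v n = 0"
  shows "v x = 0"
proof -
  have cv: "continuous_on {0..2 * pi} v"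
    using v(1) continuous_on_subset by blast
  obtain f where f: "continuous_on (sphere (0::complex) 1) f" "\<And>x. f (cis x) = v x"
    using continuous_periodic_on_circle[OF v] by blast
  have W: "integral {0..2 * pi} (\<lambda>x. of_real (v x) * cis (of_int n * x)) = 0" for n :: int
    using zero[of "- n"] by (simp add: fourier_coeff_eq_integral[OF v(1)])
  define B where "B = integral {0..2 * pi} (\<lambda>x. \<bar>v x\<bar>)"
  have small: "integral {0..2 * pi} (\<lambda>x. (v x)\<^sup>2) \<le> e * B" if "e > 0" for e
  proof -
    obtain g where g: "real_polynomial_function g" "\<And>z. z \<in> sphere 0 1 \<Longrightarrow> \<bar>f z - g z\<bar> < e"
      using Stone_Weierstrass_real_polynomial_function[OF _ f(1) \<open>e > 0\<close>] by auto
    have cg: "continuous_on {0..2 * pi} (\<lambda>x. g (cis x))"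
      using g(1) by (rule continuous_on_real_polynomial_cis)
    have "integral {0..2 * pi} (\<lambda>x. of_real (v x) * of_real (g (cis x)) * cis (of_int 0 * x)) = 0"
      by (rule real_polynomial_preserves_vanishing_coefficients[OF g(1) _ W]) (intro continuous_intros cv)
    moreover have "((\<lambda>x. complex_of_real (v x * g (cis x))) has_integral
        of_real (integral {0..2 * pi} (\<lambda>x. v x * g (cis x)))) {0..2 * pi}"
      by (intro has_integral_of_real integrable_integral integrable_continuous_interval continuous_intros cv cg)
    ultimately have 0: "integral {0..2 * pi} (\<lambda>x. v x * g (cis x)) = 0"
      by (auto dest: integral_unique)
    have "integral {0..2 * pi} (\<lambda>x. (v x)\<^sup>2) - integral {0..2 * pi} (\<lambda>x. v x * g (cis x)) =
        integral {0..2 * pi} (\<lambda>x. (v x)\<^sup>2 - v x * g (cis x))"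
      by (rule integral_diff [symmetric]) (intro integrable_continuous_interval continuous_intros cv cg)+
    also have "\<dots> \<le> integral {0..2 * pi} (\<lambda>x. e * \<bar>v x\<bar>)"
    proof (rule integral_le)
      fix x
      have "(v x)\<^sup>2 - v x * g (cis x) = v x * (f (cis x) - g (cis x))"
        by (simp add: f(2) power2_eq_square algebra_simps)
      also have "\<dots> \<le> \<bar>v x\<bar> * \<bar>f (cis x) - g (cis x)\<bar>"
        by (metis abs_ge_self abs_mult)
      also have "\<dots> \<le> \<bar>v x\<bar> * e"
        using g(2)[of "cis x"] by (intro mult_left_mono) auto
      finally show "(v x)\<^sup>2 - v x * g (cis x) \<le> e * \<bar>v x\<bar>"
        by (simp add: mult.commute)
    qed (intro integrable_continuous_interval continuous_intros cv cg)+
    finally show ?thesis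
      using 0 by (simp add: B_def)
  qed
  have "B \<ge> 0"
    unfolding B_def by (rule integral_nonneg) (auto intro!: integrable_continuous_interval continuous_intros cv)
  have "integral {0..2 * pi} (\<lambda>x. (v x)\<^sup>2) \<le> 0"
  proof (rule field_le_epsilon)
    fix e :: real assume "e > 0"
    have "e / (B + 1) * B \<le> e"
      using \<open>e > 0\<close> \<open>B \<ge> 0\<close> by (simp add: field_simps)
    then show "integral {0..2 * pi} (\<lambda>x. (v x)\<^sup>2) \<le> 0 + e"
      using small[of "e / (B + 1)"] \<open>e > 0\<close> \<open>B \<ge> 0\<close> by simp
  qed
  moreover have "integral {0..2 * pi} (\<lambda>x. (v x)\<^sup>2) \<ge> 0"
    by (rule integral_nonneg) (auto intro!: integrable_continuous_interval continuous_intros cv)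
  ultimately have "integral {0..2 * pi} (\<lambda>x. (v x)\<^sup>2) = 0"
    by simp
  then have z: "v y = 0" if "y \<in> {0..2 * pi}" for y
    using integral_eq_0_iff[of 0 "2 * pi" "\<lambda>x. (v x)\<^sup>2"] that cv
    by (simp add: continuous_on_power)
  obtain y k where "y \<in> {0..2 * pi}" "x = y + 2 * pi * of_int k"
    by (rule periodic_2pi_reduce)
  then show ?thesis
    using z periodic_2pi_shift[OF v(2)] by simp
qed

text \<open>The Taylor coefficients of the holomorphic extension of \<open>u + i Hu\<close> to the disc.\<close>

definition hardy :: "(real \<Rightarrow> real) \<Rightarrow> nat \<Rightarrow> complex" where
  "hardy u n = (if n = 0 then fourier_coeff u 0 else 2 * fourier_coeff u (int n))"

lemma fourier_coeff_minus:
  assumes "continuous_on UNIV u"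
  shows "fourier_coeff u (- n) = cnj (fourier_coeff u n)"
  by (simp add: fourier_coeff_eq_integral[OF assms] integral_cnj cis_cnj)

lemma fourier_coeff_diff:
  assumes u: "continuous_on UNIV u" and v: "continuous_on UNIV v"
  shows "fourier_coeff (\<lambda>x. u x - v x) n = fourier_coeff u n - fourier_coeff v n"
proof -
  have c: "continuous_on {0..2 * pi} u" "continuous_on {0..2 * pi} v"
    using u v continuous_on_subset by blast+
  have "integral {0..2 * pi} (\<lambda>x. of_real (u x - v x) * cis (- (of_int n * x))) =
      integral {0..2 * pi} (\<lambda>x. of_real (u x) * cis (- (of_int n * x))) -
      integral {0..2 * pi} (\<lambda>x. of_real (v x) * cis (- (of_int n * x)))"
    by (subst integral_diff [symmetric])
       (auto intro!: integrable_continuous_interval continuous_intros c simp: left_diff_distrib)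
  then show ?thesis
    using u v by (simp add: fourier_coeff_eq_integral continuous_on_diff right_diff_distrib del: of_real_diff)
qed

lemma sobolev_summable_hardy:
  assumes "u \<in> sobolev 2"
  shows "summable (\<lambda>n. real n ^ 4 * (norm (hardy u n))\<^sup>2)"
proof -
  have "(\<lambda>n::int. \<bar>real_of_int n\<bar> ^ (2 * 2) * (norm (fourier_coeff u n))\<^sup>2) summable_on range int"
    using assms by (auto simp: sobolev_def intro: summable_on_subset_banach)
  then have "(\<lambda>n. real n ^ 4 * (norm (fourier_coeff u (int n)))\<^sup>2) summable_on UNIV"
    by (subst (asm) summable_on_reindex) (auto simp: o_def)
  then have "summable (\<lambda>n. real n ^ 4 * (norm (fourier_coeff u (int n)))\<^sup>2)"
    by (rule summable_on_imp_summable)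
  then have "summable (\<lambda>n. 4 * (real n ^ 4 * (norm (fourier_coeff u (int n)))\<^sup>2))"
    by (rule summable_mult)
  also have "(\<lambda>n. 4 * (real n ^ 4 * (norm (fourier_coeff u (int n)))\<^sup>2)) =
      (\<lambda>n. real n ^ 4 * (norm (hardy u n))\<^sup>2)"
    by (auto simp: fun_eq_iff hardy_def norm_mult power_mult_distrib)
  finally show ?thesis .
qed

text \<open>The passage from functions to one-sided series. Both sides are continuous with equal
  coefficients; negative frequencies match by conjugation, and frequency 0 because the mean of a
  real function is real.\<close>

lemma sobolev_eq_Re_trig:
  assumes u: "u \<in> sobolev 2" "continuous_on UNIV u"
  shows "u = (\<lambda>x. Re (trig (hardy u) x))"
proof (rule ext)
  fix x
  note s = summable_norm_of_weighted[OF Cauchy_Schwarz_weighted(1)[OF sobolev_summable_hardy[OF u(1)]]]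
  have c: "continuous_on UNIV (\<lambda>x. Re (trig (hardy u) x))"
    using continuous_on_trig[OF s] by (intro continuous_intros)
  have "fourier_coeff u 0 = cnj (fourier_coeff u 0)"
    using fourier_coeff_minus[OF u(2), of 0] by simp
  then have "Im (fourier_coeff u 0) = 0"
    by (metis Reals_cnj_iff complex_is_Real_iff)
  then have eq: "fourier_coeff (\<lambda>x. Re (trig (hardy u) x)) n = fourier_coeff u n" for n
    using fourier_coeff_minus[OF u(2), of "n"]
    by (auto simp: fourier_coeff_Re_trig[OF s] hardy_def complex_eq_iff)
  have "u x - Re (trig (hardy u) x) = 0"
  proof (rule vanishing_fourier_coeff[where v="\<lambda>x. u x - Re (trig (hardy u) x)"])
    show "continuous_on UNIV (\<lambda>x. u x - Re (trig (hardy u) x))"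
      by (intro continuous_intros u c)
    show "periodic_2pi (\<lambda>x. u x - Re (trig (hardy u) x))"
      using u(1) by (auto simp: sobolev_def periodic_2pi_def trig_periodic)
    show "fourier_coeff (\<lambda>x. u x - Re (trig (hardy u) x)) n = 0" for n
      using fourier_coeff_diff[OF u(2) c] by (simp add: eq)
  qed
  then show "u x = Re (trig (hardy u) x)" by simp
qed

section \<open>The Hilbert transform of a trigonometric series\<close>

text \<open>This is sin(ns) cot(s/2), written as a cosine sum so that it is defined and continuous
  at s = 0 as well.\<close>

definition conj_kernel :: "nat \<Rightarrow> real \<Rightarrow> real" where
  "conj_kernel n s = (\<Sum>k<n. cos (real k * s) + cos (real (Suc k) * s))"

lemma conj_kernel_eq:
  assumes "sin (s / 2) \<noteq> 0"
  shows "conj_kernel n s = sin (real n * s) * cos (s / 2) / sin (s / 2)"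
proof -
  have "conj_kernel n s * sin (s / 2) = sin (real n * s) * cos (s / 2)"
  proof (induction n)
    case (Suc n)
    define p q where "p = real n * s" and "q = s / 2"
    have "sin (p + 2 * q) * cos q - sin p * cos q = (cos p + cos (p + 2 * q)) * sin q"
    proof -
      have "sin (p + 2 * q) * cos q - cos (p + 2 * q) * sin q = sin (p + q)"
        using sin_diff[of "p + 2 * q" q] by (simp add: add.commute)
      moreover have "sin p * cos q + cos p * sin q = sin (p + q)"
        by (simp add: sin_add)
      ultimately show ?thesis
        by (simp add: algebra_simps)
    qed
    moreover have "real (Suc n) * s = p + 2 * q"
      by (simp add: p_def q_def algebra_simps)
    moreover have "conj_kernel (Suc n) s = conj_kernel n s + (cos p + cos (real (Suc n) * s))"
      by (simp add: conj_kernel_def p_def)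
    ultimately show ?case
      using Suc.IH by (simp only: p_def[symmetric] q_def[symmetric] distrib_right)
  qed (simp add: conj_kernel_def)
  then show ?thesis
    using assms by (simp add: field_simps)
qed

lemma abs_conj_kernel_le: "\<bar>conj_kernel n s\<bar> \<le> 2 * real n"
proof -
  have "\<bar>conj_kernel n s\<bar> \<le> (\<Sum>k<n. \<bar>cos (real k * s) + cos (real (Suc k) * s)\<bar>)"
    unfolding conj_kernel_def by (rule sum_abs)
  also have "\<dots> \<le> (\<Sum>k<n. 2)"
  proof (rule sum_mono)
    show "\<bar>cos (real k * s) + cos (real (Suc k) * s)\<bar> \<le> 2" for k
      using abs_cos_le_one[of "real k * s"] abs_cos_le_one[of "real (Suc k) * s"] by linarith
  qed
  finally show ?thesis by simp
qed

lemma continuous_on_conj_kernel: "continuous_on S (conj_kernel n)"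
  unfolding conj_kernel_def[abs_def] by (intro continuous_intros)

lemma integral_cos_multiple: "((\<lambda>s. cos (real k * s)) has_integral (if k = 0 then pi else 0)) {0..pi}"
proof (cases "k = 0")
  case True
  then show ?thesis using has_integral_const_real[of "1::real" 0 pi] by simp
next
  case False
  have "((\<lambda>s. cos (real k * s)) has_integral (sin (real k * pi) / real k - sin (real k * 0) / real k)) {0..pi}"
    using False
    by (intro fundamental_theorem_of_calculus)
       (auto intro!: derivative_eq_intros simp flip: has_real_derivative_iff_has_vector_derivative)
  then show ?thesis using False by simp
qed

text \<open>Only the constant cosine has nonzero integral over \<open>{0..pi}\<close>, and it occurs
  exactly once when n >= 1.\<close>

lemma integral_conj_kernel: "integral {0..pi} (conj_kernel n) = (if n = 0 then 0 else pi)"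
proof -
  have "(conj_kernel n has_integral (\<Sum>k<n. (if k = 0 then pi else 0) + (if Suc k = 0 then pi else 0))) {0..pi}"
    unfolding conj_kernel_def[abs_def] by (intro has_integral_sum has_integral_add integral_cos_multiple) auto
  moreover have "(\<Sum>k<n. (if k = 0 then pi else 0) + (if Suc k = 0 then pi else 0)) = (if n = 0 then 0 else pi)"
    by (simp add: sum.delta)
  ultimately show ?thesis
    by (simp add: integral_unique)
qed

text \<open>The cotangent is odd, so substituting y = x - s and y = x + s on the two sides of the
  pole leaves a symmetric difference of \<open>u\<close>. Its zero at s = 0 is what will cancel the
  singularity.\<close>

lemma truncated_hilbert_integral:
  fixes u :: "real \<Rightarrow> real"
  assumes u: "continuous_on UNIV u" and e: "0 < e" "e < pi"
  shows "(LINT y:{y. e \<le> \<bar>x - y\<bar> \<and> \<bar>x - y\<bar> \<le> pi}|lborel. u y / tan ((x - y) / 2)) =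
    integral {e..pi} (\<lambda>s. (u (x - s) - u (x + s)) * cos (s / 2) / sin (s / 2))"
proof -
  define f where "f = (\<lambda>y. u y * cos ((x - y) / 2) / sin ((x - y) / 2))"
  have f: "u y / tan ((x - y) / 2) = f y" for y
    by (simp add: f_def tan_def)
  have cu: "continuous_on S u" for S
    using u continuous_on_subset by blast
  have nz: "sin ((x - y) / 2) \<noteq> 0" if "y \<in> {x - pi..x - e} \<union> {x + e..x + pi}" for y
    using that e sin_gt_zero[of "(x - y) / 2"] sin_gt_zero[of "(y - x) / 2"] pi_gt_zero sin_minus[of "(y - x) / 2"]
    by (auto simp: minus_divide_left)
  have c1: "continuous_on {x - pi..x - e} f" and c2: "continuous_on {x + e..x + pi} f"
    unfolding f_def by (intro continuous_intros cu ballI nz; simp)+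
  have split: "{y. e \<le> \<bar>x - y\<bar> \<and> \<bar>x - y\<bar> \<le> pi} = {x - pi..x - e} \<union> {x + e..x + pi}"
    using e by auto
  have i1: "set_integrable lborel {x - pi..x - e} f" and i2: "set_integrable lborel {x + e..x + pi} f"
    using borel_integrable_atLeastAtMost' c1 c2 by blast+
  have "(LINT y:{y. e \<le> \<bar>x - y\<bar> \<and> \<bar>x - y\<bar> \<le> pi}|lborel. u y / tan ((x - y) / 2)) =
      (LINT y:{x - pi..x - e}|lborel. f y) + (LINT y:{x + e..x + pi}|lborel. f y)"
    unfolding f split using e by (intro set_integral_Un i1 i2) auto
  also have "\<dots> = integral {x - pi..x - e} f + integral {x + e..x + pi} f"
    using i1 i2 by (simp add: set_borel_integral_eq_integral)
  also have "integral {x + e..x + pi} f = integral {e..pi} (\<lambda>s. f (x + s))"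
    using integral_shift[of e x pi f] c2 by (simp add: o_def add.commute)
  also have "integral {x - pi..x - e} f = integral {e..pi} (\<lambda>s. f (x - s))"
  proof -
    have "integral {x - pi..x - e} f = integral {- pi..- e} (\<lambda>s. f (x + s))"
      using integral_shift[of "- pi" x "- e" f] c1 by (simp add: o_def add.commute)
    also have "\<dots> = integral {e..pi} (\<lambda>s. f (x - s))"
      using Henstock_Kurzweil_Integration.integral_reflect_real[of pi e "\<lambda>s. f (x - s)"] by simp
    finally show ?thesis .
  qed
  also have "integral {e..pi} (\<lambda>s. f (x - s)) + integral {e..pi} (\<lambda>s. f (x + s)) =
      integral {e..pi} (\<lambda>s. f (x - s) + f (x + s))"
  proof (rule integral_add [symmetric])
    show "(\<lambda>s. f (x - s)) integrable_on {e..pi}"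
      using e by (intro integrable_continuous_interval continuous_on_compose2[OF c1]) (auto intro!: continuous_intros)
    show "(\<lambda>s. f (x + s)) integrable_on {e..pi}"
      using e by (intro integrable_continuous_interval continuous_on_compose2[OF c2]) (auto intro!: continuous_intros)
  qed
  also have "(\<lambda>s. f (x - s) + f (x + s)) = (\<lambda>s. (u (x - s) - u (x + s)) * cos (s / 2) / sin (s / 2))"
  proof
    fix t
    have "f (x + t) = u (x + t) * cos (- (t / 2)) / sin (- (t / 2))"
      unfolding f_def by (rule arg_cong2[where f="\<lambda>p q. u (x + t) * cos p / sin q"]) simp_all
    then show "f (x - t) + f (x + t) = (u (x - t) - u (x + t)) * cos (t / 2) / sin (t / 2)"
      by (simp add: f_def diff_divide_distrib left_diff_distrib)
  qed
  finally show ?thesis .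
qed

text \<open>The n-th term of u(x - s) - u(x + s) is 2 b_n sin(ns), where b_n = Im (a_n e^{inx}).
  Multiplied by the cotangent it becomes 2 b_n times \<open>conj_kernel n\<close>, bounded by 4 n
  |a_n|. The folded integrand thus extends to a continuous \<open>D\<close> on
  \<open>{0..pi}\<close>, which may be integrated termwise.\<close>

lemma hilbert_transform_Re_trig:
  assumes a: "summable (\<lambda>n. real n * norm (a n))" and a0: "Im (a 0) = 0"
  shows "hilbert_transform (\<lambda>x. Re (trig a x)) x = Im (trig a x)"
proof -
  note s = summable_norm_of_weighted[OF a]
  define u where "u = (\<lambda>x. Re (trig a x))"
  define b where "b = (\<lambda>n. Im (a n * cis (real n * x)))"
  define D where "D = (\<lambda>s. \<Sum>n. 2 * b n * conj_kernel n s)"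
  have b_le: "\<bar>b n\<bar> \<le> norm (a n)" for n
    using abs_Im_le_cmod[of "a n * cis (real n * x)"] by (simp only: b_def norm_mult norm_cis mult_1_right)
  have D_le: "norm (2 * b n * conj_kernel n s) \<le> 4 * (real n * norm (a n))" for n s
  proof -
    have "norm (2 * b n * conj_kernel n s) = 2 * (\<bar>b n\<bar> * \<bar>conj_kernel n s\<bar>)"
      by (simp add: abs_mult)
    also have "\<dots> \<le> 2 * (norm (a n) * (2 * real n))"
      by (intro mult_left_mono mult_mono b_le abs_conj_kernel_le) auto
    finally show ?thesis by (simp add: ac_simps)
  qed
  have a4: "summable (\<lambda>n. 4 * (real n * norm (a n)))"
    using a by (rule summable_mult)
  have cD: "continuous_on {0..pi} D"
    unfolding D_def using D_le a4
    by (rule continuous_on_suminf_dominated[rotated]) (auto intro!: continuous_intros continuous_on_conj_kernel)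
  have uD: "(u (x - t) - u (x + t)) * cos (t / 2) / sin (t / 2) = D t" if "sin (t / 2) \<noteq> 0" for t
  proof -
    have "(\<lambda>n. Re (a n * cis (real n * (x - t)))) sums u (x - t)" "(\<lambda>n. Re (a n * cis (real n * (x + t)))) sums u (x + t)"
      unfolding u_def trig_def by (intro sums_Re summable_sums summable_trig s)+
    then have "(\<lambda>n. Re (a n * cis (real n * (x - t))) - Re (a n * cis (real n * (x + t)))) sums (u (x - t) - u (x + t))"
      by (rule sums_diff)
    moreover have "Re (a n * cis (real n * (x - t))) - Re (a n * cis (real n * (x + t))) = 2 * b n * sin (real n * t)" for n
      by (simp add: b_def distrib_left right_diff_distrib cos_add cos_diff sin_add sin_diff algebra_simps)
    ultimately have "(\<lambda>n. 2 * b n * sin (real n * t)) sums (u (x - t) - u (x + t))"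
      by simp
    then have "(\<lambda>n. 2 * b n * sin (real n * t) * (cos (t / 2) / sin (t / 2))) sums ((u (x - t) - u (x + t)) * (cos (t / 2) / sin (t / 2)))"
      by (rule sums_mult2)
    moreover have "2 * b n * conj_kernel n t = 2 * b n * sin (real n * t) * (cos (t / 2) / sin (t / 2))" for n
      by (simp add: conj_kernel_eq[OF that])
    ultimately show ?thesis
      unfolding D_def by (simp only: sums_iff times_divide_eq_right)
  qed
  have cu: "continuous_on UNIV u"
    unfolding u_def using continuous_on_trig[OF s] by (intro continuous_intros)
  \<comment> \<open>The principal value is now an ordinary integral, continuous in its lower
    limit.\<close>
  have "((\<lambda>e. integral {e..pi} D) \<longlongrightarrow> integral {0..pi} D) (at_right 0)"
  proof -
    have "continuous_on {0..pi} (\<lambda>e. integral {e..pi} D)"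
      by (intro indefinite_integral_continuous_1' integrable_continuous_interval cD)
    then have "((\<lambda>e. integral {e..pi} D) \<longlongrightarrow> integral {0..pi} D) (at 0 within {0..pi})"
      by (auto simp: continuous_on_def)
    then show ?thesis
      by (simp add: at_within_Icc_at_right)
  qed
  moreover have "\<forall>\<^sub>F e in at_right 0. integral {e..pi} D =
      (LINT y:{y. e \<le> \<bar>x - y\<bar> \<and> \<bar>x - y\<bar> \<le> pi}|lborel. u y / tan ((x - y) / 2))"
  proof -
    have "\<forall>\<^sub>F e in at_right 0. e \<in> {0<..<pi}"
      by (rule eventually_at_right_real) simp
    then show ?thesis
    proof eventually_elim
      case (elim e)
      then have "sin (t / 2) \<noteq> 0" if "t \<in> {e..pi}" for t
        using that sin_gt_zero[of "t / 2"] by auto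
      then show ?case
        using elim by (subst truncated_hilbert_integral[OF cu]) (auto intro!: integral_cong simp: uD)
    qed
  qed
  ultimately have "((\<lambda>e. LINT y:{y. e \<le> \<bar>x - y\<bar> \<and> \<bar>x - y\<bar> \<le> pi}|lborel. u y / tan ((x - y) / 2))
      \<longlongrightarrow> integral {0..pi} D) (at_right 0)"
    by (rule Lim_transform_eventually)
  then have H: "hilbert_transform u x = (1 / (2 * pi)) * integral {0..pi} D"
    unfolding hilbert_transform_def by (subst tendsto_Lim) auto
  have "(\<lambda>n. integral {0..pi} (\<lambda>s. 2 * b n * conj_kernel n s)) sums integral {0..pi} D"
    unfolding D_def using D_le a4
    by (rule integral_suminf_dominated[rotated]) (auto intro!: continuous_intros continuous_on_conj_kernel)
  \<comment> \<open>For n = 0 the kernel vanishes, and the formula holds since \<open>a 0\<close> is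
    real.\<close>
  moreover have "integral {0..pi} (\<lambda>s. 2 * b n * conj_kernel n s) = 2 * pi * b n" for n
    using a0 by (simp add: integral_conj_kernel b_def)
  ultimately have "(\<lambda>n. 2 * pi * b n) sums integral {0..pi} D"
    by (simp only:)
  moreover have "(\<lambda>n. 2 * pi * b n) sums (2 * pi * Im (trig a x))"
    unfolding b_def trig_def by (intro sums_mult sums_Im summable_sums summable_trig s)
  ultimately show ?thesis
    using H by (simp add: sums_iff u_def)
qed

text \<open>No branch of the logarithm is chosen. With F the series and G its weighted series, F' =
  iG along the circle, and the chain and quotient rules give (Re G Re F + Im G Im F)/|F|^2, which is
  Re (G/F).\<close>

lemma flux_has_derivative:
  assumes a: "summable (\<lambda>n. real n * norm (a n))" and pos: "0 < Re (trig a x)"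
  shows "((\<lambda>y. arctan (Im (trig a y) / Re (trig a y))) has_real_derivative
     Re (trig (\<lambda>n. of_nat n * a n) x / trig a x)) (at x)"
proof -
  define G where "G = trig (\<lambda>n. of_nat n * a n) x"
  define F where "F = trig a x"
  note d = trig_has_vector_derivative[OF a, of x]
  have dR: "((\<lambda>y. Re (trig a y)) has_real_derivative - Im G) (at x)"
    using bounded_linear.has_vector_derivative[OF bounded_linear_Re d]
    by (simp add: has_real_derivative_iff_has_vector_derivative G_def)
  have dI: "((\<lambda>y. Im (trig a y)) has_real_derivative Re G) (at x)"
    using bounded_linear.has_vector_derivative[OF bounded_linear_Im d]
    by (simp add: has_real_derivative_iff_has_vector_derivative G_def)
  have F: "Re F > 0" using pos by (simp add: F_def)
  have "((\<lambda>y. arctan (Im (trig a y) / Re (trig a y))) has_real_derivative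
      inverse (1 + (Im F / Re F)\<^sup>2) * ((Re G * Re F - Im F * (- Im G)) / (Re F * Re F))) (at x)"
    unfolding F_def by (rule DERIV_chain2[OF DERIV_arctan DERIV_divide[OF dI dR]]) (use pos in simp)
  moreover have "inverse (1 + (Im F / Re F)\<^sup>2) * ((Re G * Re F - Im F * (- Im G)) / (Re F * Re F)) = Re (G / F)"
  proof -
    have "1 + (Im F / Re F)\<^sup>2 = ((Re F)\<^sup>2 + (Im F)\<^sup>2) / (Re F * Re F)"
      using F by (simp add: field_simps power2_eq_square)
    then show ?thesis
      using F by (simp add: Re_divide)
  qed
  ultimately show ?thesis
    by (simp add: F_def G_def)
qed

section \<open>Logarithmic derivatives of power series\<close>

text \<open>A Cauchy product without its two end terms: the value at n depends only on entries from
  1 to n - 1 of both factors. All triangularity in the proof comes from this.\<close>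

definition conv :: "(nat \<Rightarrow> 'a::comm_ring_1) \<Rightarrow> (nat \<Rightarrow> 'a) \<Rightarrow> nat \<Rightarrow> 'a" where
  "conv a b n = (\<Sum>j=1..<n. a j * b (n - j))"

lemma conv_commute: "conv a b n = conv b a n"
  unfolding conv_def
  by (rule sum.reindex_bij_witness[of _ "\<lambda>j. n - j" "\<lambda>j. n - j"]) (auto simp: mult.commute)

lemma conv_cong:
  assumes "\<And>k. 1 \<le> k \<Longrightarrow> k < n \<Longrightarrow> a k = a' k" "\<And>k. 1 \<le> k \<Longrightarrow> k < n \<Longrightarrow> b k = b' k"
  shows "conv a b n = conv a' b' n"
  unfolding conv_def using assms by (intro sum.cong) auto

lemma conv_mono:
  fixes a b :: "nat \<Rightarrow> real"
  assumes "\<And>k. 1 \<le> k \<Longrightarrow> k < n \<Longrightarrow> 0 \<le> a k" "\<And>k. 1 \<le> k \<Longrightarrow> k < n \<Longrightarrow> 0 \<le> b k"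
    and "\<And>k. 1 \<le> k \<Longrightarrow> k < n \<Longrightarrow> a k \<le> a' k" "\<And>k. 1 \<le> k \<Longrightarrow> k < n \<Longrightarrow> b k \<le> b' k"
  shows "conv a b n \<le> conv a' b' n"
  unfolding conv_def using assms by (intro sum_mono mult_mono) (auto intro: order_trans)

lemma conv_nonneg:
  fixes a b :: "nat \<Rightarrow> real"
  assumes "\<And>k. 1 \<le> k \<Longrightarrow> k < n \<Longrightarrow> 0 \<le> a k" "\<And>k. 1 \<le> k \<Longrightarrow> k < n \<Longrightarrow> 0 \<le> b k"
  shows "0 \<le> conv a b n"
  unfolding conv_def using assms by (intro sum_nonneg mult_nonneg_nonneg) auto

lemma norm_conv_le:
  fixes a b :: "nat \<Rightarrow> complex"
  shows "norm (conv a b n) \<le> conv (\<lambda>k. norm (a k)) (\<lambda>k. norm (b k)) n"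
  unfolding conv_def by (rule order_trans[OF norm_sum]) (simp add: norm_mult)

text \<open>The Leibniz rule for z d/dz, from n = j + (n - j).\<close>

lemma of_nat_mult_conv:
  "of_nat n * conv a b n = conv (\<lambda>k. of_nat k * a k) b n + conv a (\<lambda>k. of_nat k * b k) n"
proof -
  have "of_nat n * (a j * b (n - j)) = (of_nat j * a j) * b (n - j) + a j * (of_nat (n - j) * b (n - j))"
    if "j \<in> {1..<n}" for j
    using that by (simp add: of_nat_diff algebra_simps)
  then show ?thesis
    unfolding conv_def sum_distrib_left by (simp add: sum.distrib)
qed

text \<open>If j + k <= N with j, k >= 1, then j, k < N. So the left sum reaches one index further
  than the two on the right, and this gain drives the induction on N for the majorant.\<close>

lemma sum_conv_le_Suc:
  fixes a b :: "nat \<Rightarrow> real"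
  assumes a: "\<And>k. 0 \<le> a k" and b: "\<And>k. 0 \<le> b k"
  shows "(\<Sum>n=1..<Suc N. conv a b n) \<le> (\<Sum>n=1..<N. a n) * (\<Sum>n=1..<N. b n)"
proof -
  have "(\<Sum>n=1..<Suc N. conv a b n) = (\<Sum>(n, j)\<in>(SIGMA n:{1..<Suc N}. {1..<n}). a j * b (n - j))"
    unfolding conv_def by (rule sum.Sigma) auto
  also have "\<dots> = (\<Sum>(j, k)\<in>(\<lambda>(n, j). (j, n - j)) ` (SIGMA n:{1..<Suc N}. {1..<n}). a j * b k)"
    by (subst sum.reindex) (auto simp: inj_on_def split_def)
  also have "\<dots> \<le> (\<Sum>(j, k)\<in>{1..<N} \<times> {1..<N}. a j * b k)"
    using a b by (intro sum_mono2) auto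
  also have "\<dots> = (\<Sum>n=1..<N. a n) * (\<Sum>n=1..<N. b n)"
    by (simp add: sum_product sum.cartesian_product)
  finally show ?thesis .
qed

lemma sum_conv_le:
  fixes a b :: "nat \<Rightarrow> real"
  assumes a: "\<And>k. 0 \<le> a k" and b: "\<And>k. 0 \<le> b k"
  shows "(\<Sum>n=1..<N. conv a b n) \<le> (\<Sum>n=1..<N. a n) * (\<Sum>n=1..<N. b n)"
proof (rule order_trans[OF _ sum_conv_le_Suc[OF a b]])
  show "(\<Sum>n=1..<N. conv a b n) \<le> (\<Sum>n=1..<Suc N. conv a b n)"
    using a b by (intro sum_mono2 conv_nonneg) auto
qed

text \<open>Young's inequality l^2 * l^1 -> l^2: split b as the product of two square roots, apply
  Cauchy-Schwarz at each n, then sum with the l^1 * l^1 bound.\<close>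

lemma L2_conv_le:
  fixes a b :: "nat \<Rightarrow> real"
  assumes a: "\<And>k. 0 \<le> a k" and b: "\<And>k. 0 \<le> b k"
  shows "L2_set (conv a b) {1..<N} \<le> L2_set a {1..<N} * (\<Sum>n=1..<N. b n)"
proof -
  define B where "B = (\<Sum>n=1..<N. b n)"
  have B: "0 \<le> B" unfolding B_def using b by (intro sum_nonneg) auto
  have "(conv a b n)\<^sup>2 \<le> conv (\<lambda>k. (a k)\<^sup>2) b n * B" if n: "n \<in> {1..<N}" for n
  proof -
    have "(conv a b n)\<^sup>2 = (\<Sum>j=1..<n. (a j * sqrt (b (n - j))) * sqrt (b (n - j)))\<^sup>2"
      unfolding conv_def using b by (intro arg_cong[where f="\<lambda>x. x\<^sup>2"] sum.cong) auto
    also have "\<dots> \<le> (\<Sum>j=1..<n. (a j * sqrt (b (n - j)))\<^sup>2) * (\<Sum>j=1..<n. (sqrt (b (n - j)))\<^sup>2)"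
      by (rule Cauchy_Schwarz_ineq_sum)
    also have "\<dots> = conv (\<lambda>k. (a k)\<^sup>2) b n * (\<Sum>j=1..<n. b (n - j))"
      unfolding conv_def using b by (simp add: power_mult_distrib)
    also have "(\<Sum>j=1..<n. b (n - j)) = (\<Sum>k=1..<n. b k)"
      by (rule sum.reindex_bij_witness[of _ "\<lambda>j. n - j" "\<lambda>j. n - j"]) auto
    also have "conv (\<lambda>k. (a k)\<^sup>2) b n * (\<Sum>k=1..<n. b k) \<le> conv (\<lambda>k. (a k)\<^sup>2) b n * B"
      unfolding B_def using n b by (intro mult_left_mono sum_mono2 conv_nonneg) auto
    finally show ?thesis .
  qed
  then have "(\<Sum>n=1..<N. (conv a b n)\<^sup>2) \<le> (\<Sum>n=1..<N. conv (\<lambda>k. (a k)\<^sup>2) b n) * B"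
    by (subst sum_distrib_right) (rule sum_mono)
  also have "\<dots> \<le> ((\<Sum>n=1..<N. (a n)\<^sup>2) * B) * B"
    unfolding B_def using b by (intro mult_right_mono sum_conv_le sum_nonneg) auto
  finally have "(\<Sum>n=1..<N. (conv a b n)\<^sup>2) \<le> (\<Sum>n=1..<N. (a n)\<^sup>2) * B\<^sup>2"
    by (simp add: power2_eq_square)
  then have "sqrt (\<Sum>n=1..<N. (conv a b n)\<^sup>2) \<le> sqrt ((\<Sum>n=1..<N. (a n)\<^sup>2) * B\<^sup>2)"
    by (rule real_sqrt_le_mono)
  then show ?thesis
    using B by (simp add: L2_set_def real_sqrt_mult B_def)
qed

text \<open>For \<open>h\<^sub>0 = 1\<close> these are the coefficients of \<open>z H'(z) / H(z)\<close>, where \<open>H(z) = \<Sum>n. h\<^sub>n z\<^sup>n\<close>.\<close>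

fun qs :: "(nat \<Rightarrow> complex) \<Rightarrow> nat \<Rightarrow> complex" where
  "qs h n = of_nat n * h n - (\<Sum>j=1..<n. qs h j * h (n - j))"

declare qs.simps [simp del]

lemma qs_eq: "qs h n = of_nat n * h n - conv (qs h) h n"
  by (subst qs.simps) (simp add: conv_def)

lemma qs_0 [simp]: "qs h 0 = 0"
  by (subst qs_eq) (simp add: conv_def)

lemma qs_cong:
  assumes "\<And>k. 1 \<le> k \<Longrightarrow> k \<le> n \<Longrightarrow> h k = h' k"
  shows "qs h n = qs h' n"
  using assms
proof (induction n rule: less_induct)
  case (less n)
  have "conv (qs h) h n = conv (qs h') h' n"
    using less by (intro conv_cong) auto
  then show ?case
    using less.prems by (cases "n = 0") (auto simp: qs_eq[of _ n])
qed

text \<open>This is what lets the system be solved, and two solutions be compared, one index at a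
  time.\<close>

lemma conv_qs_cong:
  assumes "\<And>k. 1 \<le> k \<Longrightarrow> k < n \<Longrightarrow> h k = h' k"
  shows "conv (qs h) h n = conv (qs h') h' n"
  using assms by (intro conv_cong qs_cong) auto

lemma continuous_on_conv:
  fixes a b :: "'b::topological_space \<Rightarrow> nat \<Rightarrow> complex"
  assumes "\<And>k. 1 \<le> k \<Longrightarrow> k < n \<Longrightarrow> continuous_on S (\<lambda>t. a t k)"
    "\<And>k. 1 \<le> k \<Longrightarrow> k < n \<Longrightarrow> continuous_on S (\<lambda>t. b t k)"
  shows "continuous_on S (\<lambda>t. conv (a t) (b t) n)"
  unfolding conv_def by (intro continuous_intros) (use assms in auto)

lemma continuous_on_qs:
  assumes "\<And>k. 1 \<le> k \<Longrightarrow> k \<le> n \<Longrightarrow> continuous_on S (\<lambda>t. h t k)"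
  shows "continuous_on S (\<lambda>t. qs (h t) n)"
  using assms
proof (induction n rule: less_induct)
  case (less n)
  have "continuous_on S (\<lambda>t. conv (qs (h t)) (h t) n)"
    using less by (intro continuous_on_conv) auto
  then show ?case
    using less.prems by (cases "n = 0") (auto simp: qs_eq[of _ n] intro!: continuous_intros)
qed

lemma continuous_on_conv_qs:
  assumes "\<And>k. 1 \<le> k \<Longrightarrow> k < n \<Longrightarrow> continuous_on S (\<lambda>t. h t k)"
  shows "continuous_on S (\<lambda>t. conv (qs (h t)) (h t) n)"
  using assms by (intro continuous_on_conv continuous_on_qs) auto

text \<open>The identity (zH'/H) H = zH' on the boundary, as a Cauchy product of absolutely
  convergent series.\<close>

lemma trig_qs:
  assumes h: "h 0 = 1" and s: "summable (\<lambda>n. norm (h n))" "summable (\<lambda>n. norm (qs h n))"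
  shows "trig (qs h) x * trig h x = trig (\<lambda>n. of_nat n * h n) x"
proof -
  have "(\<lambda>k. \<Sum>i\<le>k. (qs h i * cis (real i * x)) * (h (k - i) * cis (real (k - i) * x))) sums
      (trig (qs h) x * trig h x)"
    unfolding trig_def by (intro Cauchy_product_sums summable_trig(2) s)
  moreover have "(\<Sum>i\<le>k. (qs h i * cis (real i * x)) * (h (k - i) * cis (real (k - i) * x))) =
      of_nat k * h k * cis (real k * x)" for k
  proof -
    have "(\<Sum>i\<le>k. (qs h i * cis (real i * x)) * (h (k - i) * cis (real (k - i) * x))) =
        (\<Sum>i\<le>k. qs h i * h (k - i)) * cis (real k * x)"
      unfolding sum_distrib_right
    proof (rule sum.cong)
      fix i assume "i \<in> {..k}"
      then have "cis (real k * x) = cis (real i * x) * cis (real (k - i) * x)"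
        by (simp add: cis_mult of_nat_diff algebra_simps)
      then show "(qs h i * cis (real i * x)) * (h (k - i) * cis (real (k - i) * x)) =
          qs h i * h (k - i) * cis (real k * x)"
        by simp
    qed simp
    also have "(\<Sum>i\<le>k. qs h i * h (k - i)) = of_nat k * h k"
    proof (cases "k = 0")
      case False
      \<comment> \<open>The term i = 0 vanishes because \<open>qs h 0 = 0\<close>, and i = k gives
        \<open>qs h k\<close> because \<open>h 0 = 1\<close>; the rest is the \<open>conv\<close>
        subtracted in the recursion.\<close>
      then have "{..k} = insert 0 (insert k {1..<k})"
        by auto
      then show ?thesis
        using False h by (simp add: qs_eq[of h k] conv_def)
    qed simp
    finally show ?thesis .
  qed
  ultimately show ?thesis
    by (simp add: trig_def sums_iff)
qed

lemma norm_qs_le: "norm (qs h n) \<le> real n * norm (h n) + conv (\<lambda>k. norm (qs h k)) (\<lambda>k. norm (h k)) n"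
proof -
  have "norm (qs h n) \<le> norm (of_nat n * h n) + norm (conv (qs h) h n)"
    unfolding qs_eq[of h n] by (rule norm_triangle_ineq4)
  then show ?thesis
    using norm_conv_le[of "qs h" h n] by (simp add: norm_mult)
qed

lemma sum_le_sum_weighted:
  fixes h :: "nat \<Rightarrow> real"
  assumes "\<And>k. 0 \<le> h k"
  shows "(\<Sum>n=1..<N. h n) \<le> (\<Sum>n=1..<N. real n * h n)"
proof (rule sum_mono)
  fix n assume "n \<in> {1..<N}"
  then show "h n \<le> real n * h n"
    using mult_right_mono[of 1 "real n" "h n"] assms by auto
qed

text \<open>Absorption: the recursion gives Q <= A + Q/2 for the truncated sums, and Q is
  finite.\<close>

lemma sum_norm_qs_le:
  assumes "(\<Sum>n=1..<N. real n * norm (h n)) \<le> 1 / 2"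
  shows "(\<Sum>n=1..<N. norm (qs h n)) \<le> 2 * (\<Sum>n=1..<N. real n * norm (h n))"
proof -
  define Q A where "Q = (\<Sum>n=1..<N. norm (qs h n))" and "A = (\<Sum>n=1..<N. real n * norm (h n))"
  have "Q \<ge> 0" unfolding Q_def by (intro sum_nonneg) auto
  have "Q \<le> (\<Sum>n=1..<N. real n * norm (h n) + conv (\<lambda>k. norm (qs h k)) (\<lambda>k. norm (h k)) n)"
    unfolding Q_def by (intro sum_mono norm_qs_le)
  also have "\<dots> \<le> A + Q * (\<Sum>n=1..<N. norm (h n))"
    using sum_conv_le[of "\<lambda>k. norm (qs h k)" "\<lambda>k. norm (h k)" N] by (simp add: sum.distrib A_def Q_def)
  also have "\<dots> \<le> A + Q * (1 / 2)"
    using sum_le_sum_weighted[of "\<lambda>k. norm (h k)" N] assms \<open>Q \<ge> 0\<close>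
    by (intro add_left_mono mult_left_mono) auto
  finally show ?thesis
    by (simp add: Q_def A_def)
qed

text \<open>This is the estimate by which damping beats the nonlinearity. The Leibniz rule puts the
  weight n on one factor, and the other factor has small l^1 norm. When it lands on
  \<open>qs\<close>, one more use of the recursion bounds Q1 by A2 + R, and R is absorbed.\<close>

lemma sum_weighted_conv_qs_le:
  assumes small: "(\<Sum>n=1..<N. real n * norm (h n)) \<le> 1 / 10"
  shows "(\<Sum>n=1..<N. real n * norm (conv (qs h) h n)) \<le> (\<Sum>n=1..<N. real n * (real n * norm (h n))) / 2"
proof -
  define R where "R = (\<Sum>n=1..<N. real n * norm (conv (qs h) h n))"
  define A1 where "A1 = (\<Sum>n=1..<N. real n * norm (h n))"
  define A2 where "A2 = (\<Sum>n=1..<N. real n * (real n * norm (h n)))"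
  define Q0 where "Q0 = (\<Sum>n=1..<N. norm (qs h n))"
  define Q1 where "Q1 = (\<Sum>n=1..<N. real n * norm (qs h n))"
  have nn: "0 \<le> Q1" "0 \<le> A1" "0 \<le> R"
    unfolding Q1_def A1_def R_def by (auto intro!: sum_nonneg)
  have A12: "A1 \<le> A2"
    unfolding A1_def A2_def by (rule sum_le_sum_weighted) auto
  have Q0: "Q0 \<le> 2 * A1"
    unfolding Q0_def A1_def using small by (intro sum_norm_qs_le) simp
  have "R \<le> (\<Sum>n=1..<N. real n * conv (\<lambda>k. norm (qs h k)) (\<lambda>k. norm (h k)) n)"
    unfolding R_def by (intro sum_mono mult_left_mono norm_conv_le) auto
  also have "\<dots> = (\<Sum>n=1..<N. conv (\<lambda>k. real k * norm (qs h k)) (\<lambda>k. norm (h k)) n) +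
      (\<Sum>n=1..<N. conv (\<lambda>k. norm (qs h k)) (\<lambda>k. real k * norm (h k)) n)"
    by (simp add: of_nat_mult_conv sum.distrib)
  also have "\<dots> \<le> Q1 * (\<Sum>n=1..<N. norm (h n)) + Q0 * A1"
    unfolding Q1_def Q0_def A1_def by (intro add_mono sum_conv_le) auto
  also have "\<dots> \<le> Q1 * (1 / 10) + (2 * A1) * (1 / 10)"
    using sum_le_sum_weighted[of "\<lambda>k. norm (h k)" N] small nn Q0
    by (intro add_mono mult_mono) (auto simp: A1_def intro: sum_nonneg)
  finally have R: "R \<le> Q1 / 10 + A1 / 5"
    by simp
  have "Q1 \<le> (\<Sum>n=1..<N. real n * (real n * norm (h n)) + real n * norm (conv (qs h) h n))"
    unfolding Q1_def distrib_left[symmetric]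
  proof (intro sum_mono mult_left_mono)
    show "norm (qs h n) \<le> real n * norm (h n) + norm (conv (qs h) h n)" for n
      using norm_triangle_ineq4[of "of_nat n * h n" "conv (qs h) h n"] by (simp add: qs_eq[of h n] norm_mult)
  qed auto
  also have "\<dots> = A2 + R"
    by (simp add: A2_def R_def sum.distrib)
  \<comment> \<open>R <= (A2 + R)/10 + A2/5, hence R <= A2/3.\<close>
  finally show ?thesis
    using R A12 nn unfolding R_def[symmetric] A2_def[symmetric] by linarith
qed

section \<open>Majorants\<close>

text \<open>\<open>maj_y c\<close> solves \<open>n y\<^sub>n = n c\<^sub>n + r\<^sub>n\<close>, where \<open>r = conv q y\<close> and \<open>q\<^sub>n = n y\<^sub>n + r\<^sub>n\<close>, with
  \<open>q = maj_q c\<close>; eliminating \<open>r\<close> from both relations gives the formula for \<open>y\<close> in terms of \<open>q\<close>.\<close>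

fun maj_q :: "(nat \<Rightarrow> real) \<Rightarrow> nat \<Rightarrow> real" where
  "maj_q c n = real n * c n +
     2 * (\<Sum>j=1..<n. maj_q c j * (c (n - j) / 2 + maj_q c (n - j) / (2 * real (n - j))))"

declare maj_q.simps [simp del]

definition maj_y :: "(nat \<Rightarrow> real) \<Rightarrow> nat \<Rightarrow> real" where
  "maj_y c n = c n / 2 + maj_q c n / (2 * real n)"

lemma maj_q_eq': "maj_q c n = real n * c n + 2 * conv (maj_q c) (maj_y c) n"
  by (subst maj_q.simps) (simp add: conv_def maj_y_def)

lemma maj_y_eq: "n \<ge> 1 \<Longrightarrow> real n * maj_y c n = real n * c n + conv (maj_q c) (maj_y c) n"
  by (simp add: maj_y_def[of c n] maj_q_eq'[of c n] field_simps)

lemma maj_q_eq: "maj_q c n = real n * maj_y c n + conv (maj_q c) (maj_y c) n"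
  by (cases "n \<ge> 1") (simp_all add: maj_y_eq maj_q_eq'[of c n] conv_def)

lemma maj_nonneg:
  assumes "\<And>n. 0 \<le> c n"
  shows "0 \<le> maj_q c n" "0 \<le> maj_y c n"
proof -
  have q: "0 \<le> maj_q c n" for n
  proof (induction n rule: less_induct)
    case (less n)
    then show ?case
      using assms by (subst maj_q.simps) (intro add_nonneg_nonneg mult_nonneg_nonneg sum_nonneg; simp)
  qed
  then show "0 \<le> maj_q c n" .
  show "0 \<le> maj_y c n"
    using assms q by (simp add: maj_y_def)
qed

text \<open>Both bounds are proved together by induction on the cutoff. The bounds below N control r
  up to N by (3a)(2a), which is at most a since a <= 1/20. This gives a + a for \<open>maj_y\<close>
  and 2a + a for \<open>maj_q\<close>.\<close>

lemma sum_maj_le: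
  assumes c: "\<And>n. 0 \<le> c n" and a: "\<And>N. (\<Sum>n=1..<N. real n * c n) \<le> a" "a \<le> 1 / 20"
  shows "(\<Sum>n=1..<N. real n * maj_y c n) \<le> 2 * a \<and> (\<Sum>n=1..<N. maj_q c n) \<le> 3 * a"
proof (induction N)
  case 0
  then show ?case using a(1)[of 0] by simp
next
  case (Suc N)
  note nn = maj_nonneg[of c, OF c]
  have "a \<ge> 0" using a(1)[of 0] by simp
  define r where "r = (\<Sum>n=1..<Suc N. conv (maj_q c) (maj_y c) n)"
  have "r \<le> (\<Sum>n=1..<N. maj_q c n) * (\<Sum>n=1..<N. maj_y c n)"
    unfolding r_def using nn by (rule sum_conv_le_Suc)
  also have "\<dots> \<le> (3 * a) * (2 * a)"
    using Suc sum_le_sum_weighted[of "maj_y c" N] nn \<open>a \<ge> 0\<close>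
    by (intro mult_mono sum_nonneg) auto
  also have "\<dots> \<le> (3 * a) * (2 * (1 / 20))"
    using a(2) \<open>a \<ge> 0\<close> by (intro mult_left_mono) auto
  finally have r: "r \<le> a"
    using \<open>a \<ge> 0\<close> by simp
  have "(\<Sum>n=1..<Suc N. real n * maj_y c n) = (\<Sum>n=1..<Suc N. real n * c n) + r"
    unfolding r_def sum.distrib[symmetric] by (intro sum.cong) (auto simp: maj_y_eq)
  then have y: "(\<Sum>n=1..<Suc N. real n * maj_y c n) \<le> 2 * a"
    using a(1)[of "Suc N"] r by linarith
  have "(\<Sum>n=1..<Suc N. maj_q c n) = (\<Sum>n=1..<Suc N. real n * maj_y c n) + r"
    unfolding r_def sum.distrib[symmetric] by (intro sum.cong) (auto simp: maj_q_eq[of c])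
  then show ?case
    using y r by linarith
qed

text \<open>The H^2 bound closes because n^2 y_n = n^2 c_n + n r_n asks for only one power of n on
  the convolution r. The Leibniz rule gives that power to one factor, measured in l^2, while the
  other factor is small in l^1.\<close>

lemma L2_maj_le:
  assumes c: "\<And>n. 0 \<le> c n" and a: "\<And>N. (\<Sum>n=1..<N. real n * c n) \<le> a" "a \<le> 1 / 20"
  shows "L2_set (\<lambda>n. (real n)\<^sup>2 * maj_y c n) {1..<N} \<le> 2 * L2_set (\<lambda>n. (real n)\<^sup>2 * c n) {1..<N}"
proof -
  let ?I = "{1..<N}"
  note nn = maj_nonneg[of c, OF c]
  define r where "r = conv (maj_q c) (maj_y c)"
  define Z where "Z = L2_set (\<lambda>n. (real n)\<^sup>2 * maj_y c n) ?I"
  define P where "P = L2_set (\<lambda>n. real n * r n) ?I"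
  have nnZ: "0 \<le> Z" "0 \<le> P" by (simp_all add: Z_def P_def)
  have sy: "(\<Sum>n=1..<N. maj_y c n) \<le> 1 / 10"
    using sum_maj_le[of c, OF c a, of N] a(2) sum_le_sum_weighted[of "maj_y c" N] nn by auto
  have sq: "(\<Sum>n=1..<N. maj_q c n) \<le> 3 / 20"
    using sum_maj_le[of c, OF c a, of N] a(2) by auto
  have "Z = L2_set (\<lambda>n. (real n)\<^sup>2 * c n + real n * r n) ?I"
    unfolding Z_def r_def
  proof (intro L2_set_cong refl)
    fix n assume "n \<in> ?I"
    then have "real n * (real n * maj_y c n) = real n * (real n * c n + conv (maj_q c) (maj_y c) n)"
      by (simp add: maj_y_eq)
    then show "(real n)\<^sup>2 * maj_y c n = (real n)\<^sup>2 * c n + real n * conv (maj_q c) (maj_y c) n"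
      by (simp add: power2_eq_square algebra_simps)
  qed
  also have "\<dots> \<le> L2_set (\<lambda>n. (real n)\<^sup>2 * c n) ?I + P"
    unfolding P_def by (rule L2_set_triangle_ineq)
  finally have Z: "Z \<le> L2_set (\<lambda>n. (real n)\<^sup>2 * c n) ?I + P" .
  have "L2_set (\<lambda>n. real n * maj_q c n) ?I = L2_set (\<lambda>n. (real n)\<^sup>2 * maj_y c n + real n * r n) ?I"
    unfolding r_def by (intro L2_set_cong) (auto simp: maj_q_eq[of c] power2_eq_square algebra_simps)
  also have "\<dots> \<le> Z + P"
    unfolding P_def Z_def by (rule L2_set_triangle_ineq)
  finally have Q: "L2_set (\<lambda>n. real n * maj_q c n) ?I \<le> Z + P" .
  have Y: "L2_set (\<lambda>n. real n * maj_y c n) ?I \<le> Z"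
    unfolding Z_def
  proof (rule L2_set_mono)
    fix n assume "n \<in> ?I"
    then have "real n * maj_y c n \<le> real n * (real n * maj_y c n)"
      using mult_right_mono[of 1 "real n" "real n * maj_y c n"] nn by auto
    then show "real n * maj_y c n \<le> (real n)\<^sup>2 * maj_y c n"
      by (simp add: power2_eq_square mult.assoc)
    show "0 \<le> real n * maj_y c n" using nn by simp
  qed
  have "P = L2_set (\<lambda>n. conv (\<lambda>k. real k * maj_q c k) (maj_y c) n + conv (\<lambda>k. real k * maj_y c k) (maj_q c) n) ?I"
    unfolding P_def r_def of_nat_mult_conv by (subst (2) conv_commute) simp
  also have "\<dots> \<le> L2_set (conv (\<lambda>k. real k * maj_q c k) (maj_y c)) ?I + L2_set (conv (\<lambda>k. real k * maj_y c k) (maj_q c)) ?I"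
    by (rule L2_set_triangle_ineq)
  also have "\<dots> \<le> L2_set (\<lambda>k. real k * maj_q c k) ?I * (\<Sum>n=1..<N. maj_y c n) +
      L2_set (\<lambda>k. real k * maj_y c k) ?I * (\<Sum>n=1..<N. maj_q c n)"
    using nn by (intro add_mono L2_conv_le) auto
  \<comment> \<open>1/10 and 3/20 are the l^1 bounds 2a and 3a at a = 1/20. Absorbing P gives P <=
    Z/2, so Z is at most twice the norm for c.\<close>
  also have "\<dots> \<le> (Z + P) * (1 / 10) + Z * (3 / 20)"
    using Q Y sy sq nn nnZ by (intro add_mono mult_mono sum_nonneg) auto
  finally have "20 * P \<le> 2 * (Z + P) + 3 * Z"
    by (simp add: field_simps)
  then have "P \<le> Z / 2"
    using nnZ by simp
  then show ?thesis
    using Z by (simp add: Z_def)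
qed

lemma summable_maj:
  assumes c: "\<And>n. 0 \<le> c n" and a: "\<And>N. (\<Sum>n=1..<N. real n * c n) \<le> a" "a \<le> 1 / 20"
  shows "summable (maj_q c)"
    and "summable (\<lambda>n. real n ^ 4 * (c n)\<^sup>2) \<Longrightarrow> summable (\<lambda>n. real n ^ 4 * (maj_y c n)\<^sup>2)"
proof -
  note nn = maj_nonneg[of c, OF c]
  have split: "(\<Sum>n<N. f n) = (\<Sum>n=1..<N. f n)" if "f 0 = 0" for f :: "nat \<Rightarrow> real" and N
    by (rule sum.mono_neutral_right) (use that in \<open>auto simp: not_le\<close>)
  have "maj_q c 0 = 0"
    by (subst maj_q.simps) simp
  then have "(\<Sum>n<N. maj_q c n) \<le> 3 * a" for N
    using sum_maj_le[of c, OF c a, of N] by (subst split) blast+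
  with nn(1) show "summable (maj_q c)"
    by (rule summableI_nonneg_bounded)
  assume s: "summable (\<lambda>n. real n ^ 4 * (c n)\<^sup>2)"
  show "summable (\<lambda>n. real n ^ 4 * (maj_y c n)\<^sup>2)"
  proof (rule summableI_nonneg_bounded)
    fix N
    have sq: "(\<Sum>n<N. real n ^ 4 * (f n)\<^sup>2) = (L2_set (\<lambda>n. (real n)\<^sup>2 * f n) {1..<N})\<^sup>2" for f :: "nat \<Rightarrow> real"
      unfolding L2_set_def by (subst split) (auto simp: sum_nonneg power_mult_distrib)
    have "(\<Sum>n<N. real n ^ 4 * (maj_y c n)\<^sup>2) \<le> (2 * L2_set (\<lambda>n. (real n)\<^sup>2 * c n) {1..<N})\<^sup>2"
      unfolding sq by (intro power_mono L2_maj_le[of c, OF c a]) auto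
    also have "\<dots> = 4 * (\<Sum>n<N. real n ^ 4 * (c n)\<^sup>2)"
      unfolding sq by (simp add: power_mult_distrib)
    also have "\<dots> \<le> 4 * (\<Sum>n. real n ^ 4 * (c n)\<^sup>2)"
      using s by (intro mult_left_mono sum_le_suminf) auto
    finally show "(\<Sum>n<N. real n ^ 4 * (maj_y c n)\<^sup>2) \<le> 4 * (\<Sum>n. real n ^ 4 * (c n)\<^sup>2)" .
  qed auto
qed

section \<open>The triangular system of ordinary differential equations\<close>

text \<open>Variation of constants with the integrating factor exp (l t).\<close>

lemma linear_ode_exists:
  fixes g :: "real \<Rightarrow> 'a::banach"
  assumes g: "continuous_on {0..} g"
  obtains r where "r 0 = r0"
    "\<And>t. t \<ge> 0 \<Longrightarrow> (r has_vector_derivative (g t - l *\<^sub>R r t)) (at t within {0..})"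
proof -
  define G where "G = (\<lambda>s. exp (l * s) *\<^sub>R g s)"
  define r where "r = (\<lambda>t. exp (- l * t) *\<^sub>R (r0 + integral {0..t} G))"
  have "r 0 = r0" by (simp add: r_def)
  moreover have "(r has_vector_derivative (g t - l *\<^sub>R r t)) (at t within {0..})" if "t \<ge> 0" for t
  proof -
    have "continuous_on {0..t + 1} G"
      unfolding G_def by (intro continuous_intros continuous_on_subset[OF g]) auto
    then have "((\<lambda>u. integral {0..u} G) has_vector_derivative G t) (at t within {0..t + 1})"
      using that by (intro integral_has_vector_derivative) auto
    moreover have "at t within {0..t + 1} = at t within {0..}"
      using that by (intro at_within_nhd[of t "{t - 1<..<t + 1}"]) auto
    ultimately have I: "((\<lambda>u. integral {0..u} G) has_vector_derivative G t) (at t within {0..})"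
      by simp
    have "((\<lambda>t. exp (- l * t)) has_real_derivative (- l * exp (- l * t))) (at t within {0..})"
      by (auto intro!: derivative_eq_intros)
    then have "(r has_vector_derivative (exp (- l * t) *\<^sub>R (0 + G t) + (- l * exp (- l * t)) *\<^sub>R (r0 + integral {0..t} G))) (at t within {0..})"
      unfolding r_def by (intro has_vector_derivative_scaleR has_vector_derivative_add has_vector_derivative_const I)
    moreover have "exp (- l * t) *\<^sub>R (0 + G t) + (- l * exp (- l * t)) *\<^sub>R (r0 + integral {0..t} G) = g t - l *\<^sub>R r t"
      by (simp add: r_def G_def exp_minus)
    ultimately show ?thesis by simp
  qed
  ultimately show ?thesis by (rule that)
qed

lemma has_vector_derivative_exp_scaleR:
  assumes "(r has_vector_derivative (g - l *\<^sub>R r t)) (at t within S)"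
  shows "((\<lambda>s. exp (l * s) *\<^sub>R r s) has_vector_derivative (exp (l * t) *\<^sub>R g)) (at t within S)"
proof -
  have "((\<lambda>s. exp (l * s)) has_real_derivative (l * exp (l * t))) (at t within S)"
    by (auto intro!: derivative_eq_intros)
  from has_vector_derivative_scaleR[OF this assms] show ?thesis
    by (simp add: scaleR_diff_right mult.commute)
qed

lemma at_within_Ici_interior: "0 < t \<Longrightarrow> at t within {0::real..} = at t"
  by (intro at_within_interior) simp

lemma continuous_on_Icc_of_vector_derivative:
  fixes F :: "real \<Rightarrow> 'a::real_normed_vector"
  assumes "\<And>s. s \<ge> 0 \<Longrightarrow> (F has_vector_derivative F' s) (at s within {0..})"
  shows "continuous_on {0..t} F"
proof (rule continuous_on_subset[of "{0..}"])
  show "continuous_on {0..} F"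
    unfolding continuous_on_eq_continuous_within
    using has_vector_derivative_continuous[OF assms] by simp
qed auto

text \<open>Comparison with a scalar supersolution \<open>b\<close>. The norm of r need not be
  differentiable where r = 0, so the mean value inequality is applied to exp (l s) r(s) and exp (l
  s) b(s) instead.\<close>

lemma linear_ode_majorant:
  fixes r g :: "real \<Rightarrow> 'a::banach" and b b' :: "real \<Rightarrow> real"
  assumes r: "\<And>t. t \<ge> 0 \<Longrightarrow> (r has_vector_derivative (g t - l *\<^sub>R r t)) (at t within {0..})"
    and b: "\<And>t. t \<ge> 0 \<Longrightarrow> (b has_vector_derivative b' t) (at t within {0..})"
    and le: "\<And>t. t \<ge> 0 \<Longrightarrow> norm (g t) \<le> b' t + l * b t"
    and "norm (r 0) \<le> b 0" "t \<ge> 0"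
  shows "norm (r t) \<le> b t"
proof (cases "t = 0")
  case False
  then have "0 < t" using assms by simp
  define f where "f = (\<lambda>s. exp (l * s) *\<^sub>R r s)"
  define p where "p = (\<lambda>s. exp (l * s) *\<^sub>R b s)"
  have f: "(f has_vector_derivative (exp (l * s) *\<^sub>R g s)) (at s within {0..})" if "s \<ge> 0" for s
    unfolding f_def by (rule has_vector_derivative_exp_scaleR[OF r[OF that]])
  have p: "(p has_vector_derivative (exp (l * s) *\<^sub>R (b' s + l * b s))) (at s within {0..})" if "s \<ge> 0" for s
    unfolding p_def using b[OF that] by (intro has_vector_derivative_exp_scaleR) simp
  have "norm (f t - f 0) \<le> p t - p 0"
  proof (rule differentiable_bound_general[OF \<open>0 < t\<close>])
    show "continuous_on {0..t} f" "continuous_on {0..t} p"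
      using continuous_on_Icc_of_vector_derivative[OF f] continuous_on_Icc_of_vector_derivative[OF p] by simp_all
    fix s assume s: "0 < s" "s < t"
    show "(f has_vector_derivative (exp (l * s) *\<^sub>R g s)) (at s)"
      using f[of s] s by (simp add: at_within_Ici_interior)
    show "(p has_vector_derivative (exp (l * s) *\<^sub>R (b' s + l * b s))) (at s)"
      using p[of s] s by (simp add: at_within_Ici_interior)
    show "norm (exp (l * s) *\<^sub>R g s) \<le> exp (l * s) *\<^sub>R (b' s + l * b s)"
      using le[of s] s by simp
  qed
  then have "norm (f t) \<le> norm (f 0) + (p t - p 0)"
    using norm_triangle_sub[of "f t" "f 0"] by linarith
  also have "\<dots> \<le> p t"
    using assms by (simp add: f_def p_def)
  finally show ?thesis
    by (simp add: f_def p_def)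
qed (use assms in simp)

text \<open>The system is stated coefficient by coefficient and asks for no summability, which is
  what makes existence unconditional.\<close>

definition qs_solution :: "real \<Rightarrow> (real \<Rightarrow> nat \<Rightarrow> complex) \<Rightarrow> bool" where
  "qs_solution \<kappa> h \<longleftrightarrow> (\<forall>n. \<forall>t\<ge>0.
     ((\<lambda>s. h s n) has_vector_derivative (- \<kappa>) *\<^sub>R qs (h t) n) (at t within {0..}))"

lemma qs_solution_has_vector_derivative:
  assumes "qs_solution \<kappa> h" "t \<ge> 0"
  shows "((\<lambda>s. h s n) has_vector_derivative (- \<kappa>) *\<^sub>R qs (h t) n) (at t within {0..})"
  using assms unfolding qs_solution_def by blast

lemma qs_solution_has_vector_derivative':
  assumes "qs_solution \<kappa> h" "t \<ge> 0"
  shows "((\<lambda>s. h s n) has_vector_derivative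
     (\<kappa> *\<^sub>R conv (qs (h t)) (h t) n - (\<kappa> * real n) *\<^sub>R h t n)) (at t within {0..})"
  using qs_solution_has_vector_derivative[OF assms, of n]
  by (simp add: qs_eq[of _ n] scaleR_conv_of_real algebra_simps)

lemma qs_solution_continuous:
  assumes "qs_solution \<kappa> h"
  shows "continuous_on {0..} (\<lambda>s. h s n)"
  unfolding continuous_on_eq_continuous_within
  using has_vector_derivative_continuous[OF qs_solution_has_vector_derivative[OF assms]] by simp

text \<open>Once the components below n are chosen, the equation for component n is linear with a
  known continuous forcing, hence solvable on all of \<open>{0..}\<close>. Well-founded choice
  assembles the components.\<close>

lemma qs_solution_exists:
  fixes c :: "nat \<Rightarrow> complex"
  obtains h where "h 0 = c" "qs_solution \<kappa> h"
proof -
  define P where "P = (\<lambda>(f :: nat \<Rightarrow> real \<Rightarrow> complex) n r. r 0 = c n \<and> (\<forall>t\<ge>0.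
     (r has_vector_derivative \<kappa> *\<^sub>R conv (qs (\<lambda>k. f k t)) (\<lambda>k. f k t) n - (\<kappa> * real n) *\<^sub>R r t) (at t within {0..})))"
  have "\<exists>f. \<forall>n. P f n (f n)"
  proof (rule dependent_wf_choice[of less_than])
    show "P f n r = P g n r" if "\<And>z. (z, n) \<in> less_than \<Longrightarrow> f z = g z" for f g n r
    proof -
      have "conv (qs (\<lambda>k. f k t)) (\<lambda>k. f k t) n = conv (qs (\<lambda>k. g k t)) (\<lambda>k. g k t) n" for t
        by (rule conv_qs_cong) (use that in simp)
      then show ?thesis by (simp add: P_def)
    qed
    show "\<exists>r. P f n r" if *: "\<And>y. (y, n) \<in> less_than \<Longrightarrow> P f y (f y)" for n f
    proof -
      have "continuous_on {0..} (f k)" if "k < n" for k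
        using *[of k] that
        by (auto simp: P_def continuous_on_eq_continuous_within intro: has_vector_derivative_continuous)
      then have "continuous_on {0..} (\<lambda>t. \<kappa> *\<^sub>R conv (qs (\<lambda>k. f k t)) (\<lambda>k. f k t) n)"
        by (intro continuous_intros continuous_on_conv_qs[of n _ "\<lambda>t k. f k t"]) auto
      then obtain r where "r 0 = c n" "\<And>t. t \<ge> 0 \<Longrightarrow>
          (r has_vector_derivative \<kappa> *\<^sub>R conv (qs (\<lambda>k. f k t)) (\<lambda>k. f k t) n - (\<kappa> * real n) *\<^sub>R r t) (at t within {0..})"
        using linear_ode_exists[of "\<lambda>t. \<kappa> *\<^sub>R conv (qs (\<lambda>k. f k t)) (\<lambda>k. f k t) n" "c n" "\<kappa> * real n"] by metis
      then show ?thesis unfolding P_def by blast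
    qed
  qed simp
  then obtain f where f: "\<And>n. P f n (f n)" by blast
  show ?thesis
  proof
    show "(\<lambda>n. f n 0) = c"
      using f by (auto simp: P_def)
    show "qs_solution \<kappa> (\<lambda>t n. f n t)"
      unfolding qs_solution_def
    proof (intro allI impI)
      fix n and t :: real assume "t \<ge> 0"
      then show "(f n has_vector_derivative (- \<kappa>) *\<^sub>R qs (\<lambda>n. f n t) n) (at t within {0..})"
        using f[of n] by (simp add: P_def qs_eq[of _ n] scaleR_conv_of_real algebra_simps)
    qed
  qed
qed

text \<open>Conservation of the mean, from \<open>qs h 0 = 0\<close>.\<close>

lemma qs_solution_0:
  assumes h: "qs_solution \<kappa> h" and "t \<ge> 0"
  shows "h t 0 = h 0 0"
proof -
  obtain c where "\<And>s. s \<in> {0..} \<Longrightarrow> h s 0 = c"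
  proof (rule has_vector_derivative_zero_constant)
    show "((\<lambda>s. h s 0) has_vector_derivative 0) (at s within {0..})" if "s \<in> {0..}" for s
      using qs_solution_has_vector_derivative[OF h, of s 0] that by simp
  qed (simp, blast)
  then show ?thesis using assms by auto
qed

text \<open>By induction the forcing at index n is at most \<kappa> M for all times, with M the
  convolution of the majorants. Against damping \<kappa> n it adds at most M/n to the initial size;
  \<kappa> cancels, so the majorant depends on the data alone.\<close>

lemma qs_solution_le_majorant:
  assumes h: "qs_solution \<kappa> h" and \<kappa>: "0 < \<kappa>" and "t \<ge> 0" "n \<ge> 1"
  defines "c \<equiv> (\<lambda>n. norm (h 0 n))"
  shows "norm (h t n) \<le> maj_y c n \<and> norm (qs (h t) n) \<le> maj_q c n"
  using \<open>t \<ge> 0\<close> \<open>n \<ge> 1\<close>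
proof (induction n arbitrary: t rule: less_induct)
  case (less n)
  have nn: "0 \<le> maj_q c n" "0 \<le> maj_y c n" for n
    by (auto intro!: maj_nonneg simp: c_def)
  define M where "M = conv (maj_q c) (maj_y c) n"
  have R: "norm (conv (qs (h s)) (h s) n) \<le> M" if "s \<ge> 0" for s
    unfolding M_def using less.IH that by (intro order_trans[OF norm_conv_le] conv_mono) auto
  \<comment> \<open>A constant supersolution: \<kappa> n (c_n + M/n) = \<kappa> n c_n + \<kappa> M
    dominates the forcing.\<close>
  have "norm (h t n) \<le> c n + M / real n"
  proof (rule linear_ode_majorant[where g="\<lambda>s. \<kappa> *\<^sub>R conv (qs (h s)) (h s) n" and l="\<kappa> * real n" and b'="\<lambda>_. 0"
        and r="\<lambda>s. h s n" and b="\<lambda>_. c n + M / real n"])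
    show "((\<lambda>s. h s n) has_vector_derivative (\<kappa> *\<^sub>R conv (qs (h s)) (h s) n - (\<kappa> * real n) *\<^sub>R h s n)) (at s within {0..})"
      if "s \<ge> 0" for s
      using h that by (rule qs_solution_has_vector_derivative')
    show "norm (\<kappa> *\<^sub>R conv (qs (h s)) (h s) n) \<le> 0 + \<kappa> * real n * (c n + M / real n)" if "s \<ge> 0" for s
    proof -
      have "norm (\<kappa> *\<^sub>R conv (qs (h s)) (h s) n) \<le> \<kappa> * M"
        using \<kappa> R[OF that] by simp
      also have "\<dots> \<le> \<kappa> * real n * c n + \<kappa> * M"
        using \<kappa> by (simp add: c_def)
      also have "\<dots> = 0 + \<kappa> * real n * (c n + M / real n)"
        using less.prems by (simp add: distrib_left)
      finally show ?thesis .
    qed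
    have "0 \<le> M" unfolding M_def using nn by (intro conv_nonneg)
    then show "norm (h 0 n) \<le> c n + M / real n"
      by (simp add: c_def)
  qed (use less.prems in auto)
  also have "\<dots> = maj_y c n"
    using less.prems maj_y_eq[of n c] by (simp add: M_def field_simps)
  finally have y: "norm (h t n) \<le> maj_y c n" .
  have "norm (qs (h t) n) \<le> norm (of_nat n * h t n) + norm (conv (qs (h t)) (h t) n)"
    unfolding qs_eq[of _ n] by (rule norm_triangle_ineq4)
  also have "\<dots> \<le> real n * maj_y c n + M"
    using y R[OF less.prems(1)] by (intro add_mono) (auto simp: norm_mult intro: mult_left_mono)
  also have "\<dots> = maj_q c n"
    by (simp add: maj_q_eq[of c n] M_def)
  finally show ?case using y by simp
qed

text \<open>A Lyapunov argument for B, the weighted sum of differentiable upper bounds b_n of the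
  norms. B' equals \<kappa> times the weighted nonlinear term minus the n^2-weighted sum of the b_n.
  Half of the latter remains, and n^2 >= n turns it into (\<kappa>/2) B.\<close>

lemma qs_solution_decay:
  assumes h: "qs_solution \<kappa> h" and \<kappa>: "0 < \<kappa>" and t: "t \<ge> 0"
    and small: "\<And>N. (\<Sum>n=1..<N. real n * norm (h 0 n)) \<le> 1 / 20"
  shows "(\<Sum>n=1..<N. real n * norm (h t n)) \<le> exp (- (\<kappa> / 2) * t) * (\<Sum>n=1..<N. real n * norm (h 0 n))"
proof -
  have hd: "((\<lambda>s. h s n) has_vector_derivative (\<kappa> *\<^sub>R conv (qs (h s)) (h s) n - (\<kappa> * real n) *\<^sub>R h s n)) (at s within {0..})"
    if "s \<ge> 0" for s n
    using h that by (rule qs_solution_has_vector_derivative')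
  note hc = qs_solution_continuous[OF h]
  define R where "R = (\<lambda>n s. norm (conv (qs (h s)) (h s) n))"
  \<comment> \<open>b_n solves the equation with the norm of the forcing, so it dominates
    \<open>norm (h t n)\<close> and is differentiable even where that norm is not.\<close>
  have "\<exists>b. b 0 = norm (h 0 n) \<and> (\<forall>t\<ge>0. (b has_vector_derivative (\<kappa> * R n t - (\<kappa> * real n) *\<^sub>R b t)) (at t within {0..}))" for n
  proof -
    have "continuous_on {0..} (\<lambda>s. \<kappa> * R n s)"
      unfolding R_def by (intro continuous_intros continuous_on_conv_qs hc)
    from linear_ode_exists[OF this, of "norm (h 0 n)" "\<kappa> * real n"] show ?thesis
      by blast
  qed
  then obtain b where b0: "\<And>n. b n 0 = norm (h 0 n)"
    and bd: "\<And>n t. t \<ge> 0 \<Longrightarrow> (b n has_vector_derivative (\<kappa> * R n t - (\<kappa> * real n) *\<^sub>R b n t)) (at t within {0..})"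
    by metis
  have hb: "norm (h s n) \<le> b n s" if "s \<ge> 0" for n s
  proof (rule linear_ode_majorant[where r="\<lambda>s. h s n" and b="b n", OF hd bd])
    show "norm (\<kappa> *\<^sub>R conv (qs (h s)) (h s) n) \<le> \<kappa> * R n s - (\<kappa> * real n) *\<^sub>R b n s + \<kappa> * real n * b n s" for s
      using \<kappa> by (simp add: R_def)
  qed (simp_all add: b0 that)
  \<comment> \<open>The smallness required by the nonlinear estimate comes from the majorant, so no
    continuation argument is needed here.\<close>
  have small_t: "(\<Sum>n=1..<N. real n * norm (h s n)) \<le> 1 / 10" if "s \<ge> 0" for s
  proof -
    have "(\<Sum>n=1..<N. real n * norm (h s n)) \<le> (\<Sum>n=1..<N. real n * maj_y (\<lambda>n. norm (h 0 n)) n)"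
      using qs_solution_le_majorant[OF h \<kappa> that] by (intro sum_mono mult_left_mono) auto
    also have "\<dots> \<le> 2 * (1 / 20)"
      using sum_maj_le[of "\<lambda>n. norm (h 0 n)" "1 / 20" N] small by simp
    finally show ?thesis by simp
  qed
  define B where "B = (\<lambda>s. \<Sum>n=1..<N. real n * b n s)"
  define E where "E = (\<lambda>s. exp (\<kappa> / 2 * s) * B s)"
  have Bd: "(B has_vector_derivative (\<Sum>n=1..<N. real n * (\<kappa> * R n s - (\<kappa> * real n) * b n s))) (at s within {0..})" if "s \<ge> 0" for s
    unfolding B_def
    using bd[OF that] by (intro has_vector_derivative_sum has_vector_derivative_mult_right) simp
  have B': "(\<Sum>n=1..<N. real n * (\<kappa> * R n s - (\<kappa> * real n) * b n s)) \<le> - (\<kappa> / 2) * B s" if "s \<ge> 0" for s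
  proof -
    have "(\<Sum>n=1..<N. real n * R n s) \<le> (\<Sum>n=1..<N. real n * (real n * norm (h s n))) / 2"
      unfolding R_def by (rule sum_weighted_conv_qs_le[OF small_t[OF that]])
    also have "\<dots> \<le> (\<Sum>n=1..<N. real n * (real n * b n s)) / 2"
      using hb[OF that] by (intro divide_right_mono sum_mono mult_left_mono) auto
    finally have 1: "(\<Sum>n=1..<N. real n * R n s) \<le> (\<Sum>n=1..<N. real n * (real n * b n s)) / 2" .
    have "B s \<le> (\<Sum>n=1..<N. real n * (real n * b n s))"
      unfolding B_def
    proof (rule sum_mono)
      fix n assume "n \<in> {1..<N}"
      moreover have "0 \<le> b n s"
        using hb[OF that, of n] norm_ge_zero order_trans by blast
      ultimately show "real n * b n s \<le> real n * (real n * b n s)"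
        using mult_right_mono[of 1 "real n" "real n * b n s"] by auto
    qed
    with 1 have "\<kappa> * ((\<Sum>n=1..<N. real n * R n s) - (\<Sum>n=1..<N. real n * (real n * b n s))) \<le> \<kappa> * (- B s / 2)"
      using \<kappa> by (intro mult_left_mono) auto
    moreover have "(\<Sum>n=1..<N. real n * (\<kappa> * R n s - (\<kappa> * real n) * b n s)) =
        \<kappa> * ((\<Sum>n=1..<N. real n * R n s) - (\<Sum>n=1..<N. real n * (real n * b n s)))"
      by (simp add: sum_subtractf[symmetric] sum_distrib_left algebra_simps)
    ultimately show ?thesis by simp
  qed
  have Ed: "(E has_real_derivative (exp (\<kappa> / 2 * s) * ((\<Sum>n=1..<N. real n * (\<kappa> * R n s - (\<kappa> * real n) * b n s)) + \<kappa> / 2 * B s))) (at s within {0..})"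
    if "s \<ge> 0" for s
    unfolding E_def using Bd[OF that, folded has_real_derivative_iff_has_vector_derivative]
    by (auto intro!: derivative_eq_intros simp: algebra_simps)
  have "E t \<le> E 0"
    using t
  proof (rule DERIV_nonpos_imp_decreasing_open)
    show "\<exists>y. (E has_real_derivative y) (at s) \<and> y \<le> 0" if "0 < s" "s < t" for s
    proof (intro exI conjI)
      show "(E has_real_derivative (exp (\<kappa> / 2 * s) * ((\<Sum>n=1..<N. real n * (\<kappa> * R n s - (\<kappa> * real n) * b n s)) + \<kappa> / 2 * B s))) (at s)"
        using Ed[of s] that by (simp add: at_within_Ici_interior)
      show "exp (\<kappa> / 2 * s) * ((\<Sum>n=1..<N. real n * (\<kappa> * R n s - (\<kappa> * real n) * b n s)) + \<kappa> / 2 * B s) \<le> 0"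
        using B'[of s] that by (intro mult_nonneg_nonpos) auto
    qed
    show "continuous_on {0..t} E"
      by (rule continuous_on_Icc_of_vector_derivative, rule Ed[unfolded has_real_derivative_iff_has_vector_derivative])
  qed
  then have "B t \<le> exp (- (\<kappa> / 2) * t) * B 0"
    by (simp add: E_def exp_minus field_simps)
  moreover have "(\<Sum>n=1..<N. real n * norm (h t n)) \<le> B t"
    unfolding B_def using hb[OF t] by (intro sum_mono mult_left_mono) auto
  ultimately show ?thesis
    by (simp add: B_def b0)
qed

text \<open>Given agreement below n, the nonlinear parts coincide and the difference solves y' =
  -\<kappa> n y with y(0) = 0. The competitor \<open>k\<close> need only be continuous at the right
  end \<tau>, because its equation will be known only before smallness can fail.\<close>

lemma qs_solution_unique:
  assumes h: "qs_solution \<kappa> h" and init: "k 0 = h 0"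
    and kc: "\<And>n. continuous_on {0..\<tau>} (\<lambda>s. k s n)"
    and kd: "\<And>n t. 0 \<le> t \<Longrightarrow> t < \<tau> \<Longrightarrow>
      ((\<lambda>s. k s n) has_vector_derivative (- \<kappa>) *\<^sub>R qs (k t) n) (at t within {0..\<tau>})"
    and t: "t \<in> {0..\<tau>}"
  shows "k t n = h t n"
  using t
proof (induction n arbitrary: t rule: less_induct)
  case (less n)
  define D where "D = (\<lambda>s. exp (\<kappa> * real n * s) *\<^sub>R (k s n - h s n))"
  have hc: "continuous_on {0..\<tau>} (\<lambda>s. h s n)"
    by (rule continuous_on_subset[OF qs_solution_continuous[OF h]]) auto
  have "D t = 0"
  proof (rule has_derivative_zero_unique_strong_interval[of "{\<tau>}" 0 \<tau>])
    show "continuous_on {0..\<tau>} D"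
      unfolding D_def by (intro continuous_intros kc hc)
    show "D 0 = 0" by (simp add: D_def init)
    fix s assume s: "s \<in> {0..\<tau>} - {\<tau>}"
    have "((\<lambda>s. h s n) has_vector_derivative (- \<kappa>) *\<^sub>R qs (h s) n) (at s within {0..\<tau>})"
      using s by (intro has_vector_derivative_within_subset[OF qs_solution_has_vector_derivative[OF h]]) auto
    with kd[of s n] s have "((\<lambda>s. k s n - h s n) has_vector_derivative
        ((- \<kappa>) *\<^sub>R qs (k s) n - (- \<kappa>) *\<^sub>R qs (h s) n)) (at s within {0..\<tau>})"
      by (intro has_vector_derivative_diff) auto
    moreover have "conv (qs (k s)) (k s) n = conv (qs (h s)) (h s) n"
      using less.IH s by (intro conv_qs_cong) auto
    then have "(- \<kappa>) *\<^sub>R qs (k s) n - (- \<kappa>) *\<^sub>R qs (h s) n = 0 - (\<kappa> * real n) *\<^sub>R (k s n - h s n)"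
      by (simp add: qs_eq[of _ n] scaleR_conv_of_real algebra_simps)
    ultimately have "((\<lambda>s. k s n - h s n) has_vector_derivative
        (0 - (\<kappa> * real n) *\<^sub>R (k s n - h s n))) (at s within {0..\<tau>})"
      by simp
    from has_vector_derivative_exp_scaleR[OF this] show "(D has_derivative (\<lambda>h. 0)) (at s within {0..\<tau>})"
      by (simp add: D_def has_vector_derivative_def)
  qed (use less.prems in auto)
  then show ?case
    by (simp add: D_def)
qed

section \<open>Existence and decay\<close>

lemma fourier_coeff_0: "fourier_coeff u 0 = of_real (circle_mean u)"
proof -
  have "(LINT x:{0..2 * pi}|lborel. complex_of_real (u x)) = of_real (LINT x:{0..2 * pi}|lborel. u x)"
    unfolding set_lebesgue_integral_def
    by (subst integral_complex_of_real [symmetric]) (simp add: scaleR_conv_of_real)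
  then show ?thesis
    by (simp add: fourier_coeff_def circle_mean_def)
qed

lemma circle_mean_pos:
  assumes u: "continuous_on UNIV u" "\<And>x. 0 < u x"
  shows "0 < circle_mean u"
proof -
  have c: "continuous_on {0..2 * pi} u"
    using u(1) continuous_on_subset by blast
  have "0 \<le> integral {0..2 * pi} u"
    using u(2) by (intro integral_nonneg integrable_continuous_interval c) (auto intro: less_imp_le)
  moreover have "integral {0..2 * pi} u = 0 \<longleftrightarrow> (\<forall>x\<in>{0..2 * pi}. u x = 0)"
    by (rule integral_eq_0_iff[OF c]) (use u(2) in \<open>auto intro: less_imp_le\<close>)
  then have "integral {0..2 * pi} u \<noteq> 0"
    using u(2)[of 0] by (metis atLeastAtMost_iff less_irrefl order_refl pi_ge_zero zero_le_mult_iff zero_le_numeral)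
  ultimately show ?thesis
    using borel_integrable_atLeastAtMost'[OF c]
    by (simp add: circle_mean_def set_borel_integral_eq_integral)
qed

lemma trig_remove_0:
  assumes "summable (\<lambda>n. norm (a n))"
  shows "trig a x - a 0 = trig (a(0 := 0)) x"
proof -
  define b where "b = (\<lambda>n::nat. if n = 0 then a 0 else 0)"
  have "(\<lambda>n. b n * cis (real n * x)) sums (\<Sum>n\<in>{0}. b n * cis (real n * x))"
    by (rule sums_finite) (auto simp: b_def)
  then have "trig b x = a 0"
    by (simp add: trig_def sums_iff b_def)
  moreover have "summable (\<lambda>n. norm (b n))"
    by (rule summable_finite[of "{0}"]) (auto simp: b_def)
  moreover have "(\<lambda>n. a n - b n) = a(0 := 0)"
    by (auto simp: b_def)
  ultimately show ?thesis
    using trig_diff[OF assms, of b x] by simp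
qed

lemma wiener_norm_Re_trig_minus_mean:
  assumes a: "summable (\<lambda>n. real n * norm (a n))"
  shows "wiener_norm 1 (\<lambda>x. Re (trig a x) - Re (a 0)) = (\<Sum>n. real n * norm (a n))"
proof -
  have eq: "real n * norm ((a(0 := 0)) n) = real n * norm (a n)" for n
    by simp
  have "Re (trig a x) - Re (a 0) = Re (trig (a(0 := 0)) x)" for x
    using arg_cong[OF trig_remove_0[OF summable_norm_of_weighted[OF a], of x], of Re] by simp
  then have "wiener_norm 1 (\<lambda>x. Re (trig a x) - Re (a 0)) = wiener_norm 1 (\<lambda>x. Re (trig (a(0 := 0)) x))"
    by simp
  also have "\<dots> = (\<Sum>n. real n * norm ((a(0 := 0)) n))"
    using a by (intro wiener_norm_Re_trig) (simp only: eq)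
  finally show ?thesis
    by (simp only: eq)
qed

text \<open>The series stays within 1/2 of its constant term 1.\<close>

lemma Re_trig_pos:
  assumes h: "h 0 = 1" and s: "summable (\<lambda>n. real n * norm (h n))" and small: "(\<Sum>n. real n * norm (h n)) \<le> 1 / 2"
  shows "0 < Re (trig h x)"
proof -
  have eq: "norm ((h(0 := 0)) n) \<le> real n * norm (h n)" for n
    using mult_right_mono[of 1 "real n" "norm (h n)"] by auto
  have s0: "summable (\<lambda>n. norm ((h(0 := 0)) n))"
    using eq by (intro summable_comparison_test'[OF s]) auto
  have "norm (trig h x - 1) \<le> (\<Sum>n. norm ((h(0 := 0)) n))"
    using trig_remove_0[OF summable_norm_of_weighted[OF s], of x] norm_trig_le[OF s0, of x] by (simp only: h)
  also have "\<dots> \<le> (\<Sum>n. real n * norm (h n))"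
    using eq s0 s by (intro suminf_le)
  finally have "norm (trig h x - 1) \<le> 1 / 2"
    using small by simp
  then have "\<bar>Re (trig h x - 1)\<bar> \<le> 1 / 2"
    using abs_Re_le_cmod order_trans by blast
  then show ?thesis
    by (simp only: minus_complex.sel one_complex.sel abs_le_iff) linarith
qed

text \<open>A Poincare inequality for mean zero: every remaining frequency has n^4 >= 1.\<close>

lemma sobolev_norm_0_le:
  assumes s: "summable (\<lambda>n. real n ^ 4 * (norm (a n))\<^sup>2)" and a: "Re (a 0) = 0"
  shows "sobolev_norm 0 (\<lambda>x. Re (trig a x)) \<le> sobolev_norm 2 (\<lambda>x. Re (trig a x))"
proof -
  note s0 = sobolev_norm_0_Re_trig[OF s]
  have s': "summable (\<lambda>n. real (Suc n) ^ 4 * (norm (a (Suc n)))\<^sup>2)"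
    using s by (subst summable_Suc_iff)
  have "(\<Sum>n. (norm (a (Suc n)))\<^sup>2) \<le> (\<Sum>n. real (Suc n) ^ 4 * (norm (a (Suc n)))\<^sup>2)"
  proof (rule suminf_le[OF _ s0(1) s'])
    show "(norm (a (Suc n)))\<^sup>2 \<le> real (Suc n) ^ 4 * (norm (a (Suc n)))\<^sup>2" for n
      using mult_right_mono[of 1 "real (Suc n) ^ 4" "(norm (a (Suc n)))\<^sup>2"] one_le_power[of "real (Suc n)" 4] by simp
  qed
  also have "\<dots> = (\<Sum>n. real n ^ 4 * (norm (a n))\<^sup>2)"
    using suminf_split_head[OF s] by simp
  finally show ?thesis
    unfolding s0(2) Re_trig_sobolev(2)[OF s] using a by (intro real_sqrt_le_mono) simp
qed

section \<open>The constructed solution for small data\<close>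

text \<open>\<open>h\<close> holds the coefficients divided by the conserved mean \<open>m\<close>,
  whence \<kappa> = 1/m and \<open>h 0 0 = 1\<close>. Apart from the evolution itself, all
  assumptions concern time 0.\<close>

locale small_solution =
  fixes m :: real and h :: "real \<Rightarrow> nat \<Rightarrow> complex"
  assumes m: "0 < m" and h: "qs_solution (1 / m) h" and h00: "h 0 0 = 1"
    and s4: "summable (\<lambda>n. real n ^ 4 * (norm (h 0 n))\<^sup>2)"
    and small: "(\<Sum>n. real n * norm (h 0 n)) \<le> 1 / 20"
begin

definition c :: "nat \<Rightarrow> real" where "c n = norm (h 0 n)"

lemma sum_c: "(\<Sum>n=1..<N. real n * c n) \<le> 1 / 20"
proof -
  have "(\<Sum>n=1..<N. real n * c n) \<le> (\<Sum>n. real n * norm (h 0 n))"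
    unfolding c_def using Cauchy_Schwarz_weighted(1)[OF s4] by (intro sum_le_suminf) auto
  then show ?thesis using small by simp
qed

lemma c_nonneg: "0 \<le> c n"
  by (simp add: c_def)

lemma summable_q: "summable (maj_q c)"
  using c_nonneg sum_c by (rule summable_maj) simp

lemma summable_y: "summable (\<lambda>n. real n ^ 4 * (maj_y c n)\<^sup>2)"
  using c_nonneg sum_c by (rule summable_maj) (use s4 in \<open>simp_all add: c_def\<close>)

lemma le_majorant:
  assumes "t \<ge> 0" "n \<ge> 1"
  shows "norm (h t n) \<le> maj_y c n" "norm (qs (h t) n) \<le> maj_q c n"
  using qs_solution_le_majorant[OF h _ assms] m by (simp_all add: c_def[abs_def])

lemma qs_le: "t \<ge> 0 \<Longrightarrow> norm (qs (h t) n) \<le> maj_q c n"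
  using le_majorant(2)[of t n] maj_nonneg(1)[of c n, OF c_nonneg] by (cases "n = 0") auto

lemma summable_qs: "t \<ge> 0 \<Longrightarrow> summable (\<lambda>n. norm (qs (h t) n))"
  using qs_le by (intro summable_comparison_test'[OF summable_q]) auto

lemma summable_h4:
  assumes "t \<ge> 0"
  shows "summable (\<lambda>n. real n ^ 4 * (norm (h t n))\<^sup>2)"
proof (rule summable_comparison_test'[OF summable_y])
  show "norm (real n ^ 4 * (norm (h t n))\<^sup>2) \<le> real n ^ 4 * (maj_y c n)\<^sup>2" for n
    using le_majorant(1)[OF assms, of n] by (cases "n = 0") (auto intro!: mult_left_mono power_mono)
qed

lemmas summable_h1 = Cauchy_Schwarz_weighted(1)[OF summable_h4]
lemmas summable_h0 = summable_norm_of_weighted[OF summable_h1]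

lemma h_0: "t \<ge> 0 \<Longrightarrow> h t 0 = 1"
  using qs_solution_0[OF h] h00 by simp

lemma decay:
  assumes "t \<ge> 0"
  shows "(\<Sum>n. real n * norm (h t n)) \<le> exp (- (1 / (2 * m)) * t) * (\<Sum>n. real n * norm (h 0 n))"
proof (rule suminf_le_const[OF summable_h1[OF assms]])
  fix N
  have "(\<Sum>n<N. real n * norm (h t n)) = (\<Sum>n=1..<N. real n * norm (h t n))"
    by (rule sum.mono_neutral_right) (auto simp: not_le)
  also have "\<dots> \<le> exp (- (1 / m / 2) * t) * (\<Sum>n=1..<N. real n * norm (h 0 n))"
    using m sum_c assms by (intro qs_solution_decay[OF h]) (auto simp: c_def)
  also have "\<dots> \<le> exp (- (1 / m / 2) * t) * (\<Sum>n. real n * norm (h 0 n))"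
    using summable_h1[of 0] by (intro mult_left_mono sum_le_suminf) auto
  finally show "(\<Sum>n<N. real n * norm (h t n)) \<le> exp (- (1 / (2 * m)) * t) * (\<Sum>n. real n * norm (h 0 n))"
    by (simp add: field_simps)
qed

lemma small_t:
  assumes "t \<ge> 0"
  shows "(\<Sum>n. real n * norm (h t n)) \<le> 1 / 20"
proof -
  have "exp (- (1 / (2 * m)) * t) * (\<Sum>n. real n * norm (h 0 n)) \<le> 1 * (1 / 20)"
    using assms m small summable_h1[of 0] by (intro mult_mono suminf_nonneg) auto
  then show ?thesis using decay[OF assms] by simp
qed

definition u :: "real \<Rightarrow> real \<Rightarrow> real" where
  "u t x = Re (trig (\<lambda>n. of_real m * h t n) x)"

lemma u_eq: "t \<ge> 0 \<Longrightarrow> u t x = m * Re (trig (h t) x)"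
  unfolding u_def by (simp add: trig_cmult[OF summable_h0])

lemma summable_m:
  assumes "t \<ge> 0"
  shows "summable (\<lambda>n. real n ^ 4 * (norm (of_real m * h t n))\<^sup>2)"
    "summable (\<lambda>n. real n * norm (of_real m * h t n))"
proof -
  show "summable (\<lambda>n. real n ^ 4 * (norm (of_real m * h t n))\<^sup>2)"
    using summable_mult[OF summable_h4[OF assms], of "m\<^sup>2"] m
    by (simp add: norm_mult power_mult_distrib ac_simps)
  then show "summable (\<lambda>n. real n * norm (of_real m * h t n))"
    by (rule Cauchy_Schwarz_weighted(1))
qed

text \<open>The third bound does not involve the two times. It is the dominating series for
  Tannery's theorem in the proof of continuity in H^2.\<close>

lemma u_diff:
  assumes "r \<ge> 0" "t \<ge> 0"
  shows "u r x - u t x = Re (trig (\<lambda>n. of_real m * (h r n - h t n)) x)"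
    and "summable (\<lambda>n. real n ^ 4 * (norm (of_real m * (h r n - h t n)))\<^sup>2)"
    and "real n ^ 4 * (norm (of_real m * (h r n - h t n)))\<^sup>2 \<le> 4 * m\<^sup>2 * (real n ^ 4 * (maj_y c n)\<^sup>2)"
proof -
  show "u r x - u t x = Re (trig (\<lambda>n. of_real m * (h r n - h t n)) x)"
    using trig_diff[OF summable_norm_of_weighted[OF summable_m(2)[OF assms(1)]]
        summable_norm_of_weighted[OF summable_m(2)[OF assms(2)]], of x]
    by (simp add: u_def right_diff_distrib flip: minus_complex.sel)
  have *: "real n ^ 4 * (norm (of_real m * (h r n - h t n)))\<^sup>2 \<le> 4 * m\<^sup>2 * (real n ^ 4 * (maj_y c n)\<^sup>2)" for n
  proof (cases "n = 0")
    case False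
    then have "norm (h r n - h t n) \<le> 2 * maj_y c n"
      using le_majorant(1)[OF assms(1), of n] le_majorant(1)[OF assms(2), of n] norm_triangle_ineq4[of "h r n" "h t n"]
      by simp
    then have "(norm (h r n - h t n))\<^sup>2 \<le> (2 * maj_y c n)\<^sup>2"
      by (intro power_mono) auto
    then have "(real n ^ 4 * m\<^sup>2) * (norm (h r n - h t n))\<^sup>2 \<le> (real n ^ 4 * m\<^sup>2) * (2 * maj_y c n)\<^sup>2"
      by (intro mult_left_mono) auto
    then show ?thesis
      by (simp add: norm_mult power_mult_distrib ac_simps)
  qed simp
  show "real n ^ 4 * (norm (of_real m * (h r n - h t n)))\<^sup>2 \<le> 4 * m\<^sup>2 * (real n ^ 4 * (maj_y c n)\<^sup>2)"
    by (rule *)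
  show "summable (\<lambda>n. real n ^ 4 * (norm (of_real m * (h r n - h t n)))\<^sup>2)"
    using * by (intro summable_comparison_test'[OF summable_mult[OF summable_y, of "4 * m\<^sup>2"]]) auto
qed

lemma continuous_in_H2_u: "continuous_in_H2 {0..} u"
  unfolding continuous_in_H2_def
proof (intro conjI ballI)
  fix t :: real assume t: "t \<in> {0..}"
  show "u t \<in> sobolev 2"
    unfolding u_def using t by (intro Re_trig_sobolev summable_m) simp
  let ?F = "at t within {0..}"
  have ev: "\<forall>\<^sub>F r in ?F. r \<ge> 0"
    by (simp add: eventually_at_filter)
  have n2: "sobolev_norm 2 (\<lambda>x. u r x - u t x) = sqrt (pi * (\<Sum>n. real n ^ 4 * (norm (of_real m * (h r n - h t n)))\<^sup>2))"
    if "r \<ge> 0" for r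
    using Re_trig_sobolev(2)[OF u_diff(2)[of r t]] u_diff(1)[of r t] that t by simp
  have "((\<lambda>r. \<Sum>n. real n ^ 4 * (norm (of_real m * (h r n - h t n)))\<^sup>2) \<longlongrightarrow> 0) ?F"
  proof (cases "?F = bot")
    case False
    have "((\<lambda>r. \<Sum>n. real n ^ 4 * (norm (of_real m * (h r n - h t n)))\<^sup>2) \<longlongrightarrow> (\<Sum>n. 0)) ?F"
    proof (rule tannerys_theorem[THEN conjunct2, THEN conjunct2])
      fix n
      have "((\<lambda>r. h r n) \<longlongrightarrow> h t n) ?F"
        using qs_solution_continuous[OF h, of n] t by (auto simp: continuous_on_def)
      then have "((\<lambda>r. real n ^ 4 * (norm (of_real m * (h r n - h t n)))\<^sup>2) \<longlongrightarrow>
          real n ^ 4 * (norm (of_real m * (h t n - h t n)))\<^sup>2) ?F"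
        by (intro tendsto_intros)
      then show "((\<lambda>r. real n ^ 4 * (norm (of_real m * (h r n - h t n)))\<^sup>2) \<longlongrightarrow> 0) ?F"
        by simp
      show "\<forall>\<^sub>F (n, r) in sequentially \<times>\<^sub>F ?F. norm (real n ^ 4 * (norm (of_real m * (h r n - h t n)))\<^sup>2)
          \<le> 4 * m\<^sup>2 * (real n ^ 4 * (maj_y c n)\<^sup>2)"
        unfolding eventually_prod_filter
        using ev u_diff(3)[of _ t] t
        by (intro exI[of _ "\<lambda>_. True"] exI[of _ "\<lambda>r. r \<ge> 0"]) auto
      show "summable (\<lambda>n. 4 * m\<^sup>2 * (real n ^ 4 * (maj_y c n)\<^sup>2))"
        by (rule summable_mult[OF summable_y])
    qed (rule False)
    then show ?thesis by simp
  qed simp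
  then have "((\<lambda>r. sqrt (pi * (\<Sum>n. real n ^ 4 * (norm (of_real m * (h r n - h t n)))\<^sup>2))) \<longlongrightarrow> sqrt (pi * 0)) ?F"
    by (intro tendsto_intros)
  moreover have "\<forall>\<^sub>F r in ?F. sqrt (pi * (\<Sum>n. real n ^ 4 * (norm (of_real m * (h r n - h t n)))\<^sup>2)) =
      sobolev_norm 2 (\<lambda>x. u r x - u t x)"
    using ev by eventually_elim (simp only: n2)
  ultimately have "((\<lambda>r. sobolev_norm 2 (\<lambda>x. u r x - u t x)) \<longlongrightarrow> sqrt (pi * 0)) ?F"
    by (rule Lim_transform_eventually)
  then show lim2: "((\<lambda>r. sobolev_norm 2 (\<lambda>x. u r x - u t x)) \<longlongrightarrow> 0) ?F"
    by simp
  \<comment> \<open>The mean is conserved, so differences have mean zero and the L^2 norm is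
    controlled by the H^2 seminorm.\<close>
  show "((\<lambda>r. sobolev_norm 0 (\<lambda>x. u r x - u t x)) \<longlongrightarrow> 0) ?F"
  proof (rule Lim_null_comparison[OF _ lim2])
    show "\<forall>\<^sub>F r in ?F. norm (sobolev_norm 0 (\<lambda>x. u r x - u t x)) \<le> sobolev_norm 2 (\<lambda>x. u r x - u t x)"
      using ev
    proof eventually_elim
      case (elim r)
      have "sobolev_norm 0 (\<lambda>x. u r x - u t x) \<le> sobolev_norm 2 (\<lambda>x. u r x - u t x)"
        unfolding u_diff(1)[OF elim t[simplified]]
        using elim t h_0 by (intro sobolev_norm_0_le u_diff(2)) auto
      moreover have "0 \<le> sobolev_norm 0 (\<lambda>x. u r x - u t x)"
        unfolding sobolev_norm_def by (intro real_sqrt_ge_zero mult_nonneg_nonneg infsum_nonneg) auto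
      ultimately show ?case by simp
    qed
  qed
qed

lemma trig_h_pos: "t \<ge> 0 \<Longrightarrow> 0 < Re (trig (h t) x)"
  using small_t[of t] by (intro Re_trig_pos h_0 summable_h1) auto

lemma quotient_eq:
  assumes t: "t \<ge> 0"
  shows "trig (\<lambda>n. of_nat n * (of_real m * h t n)) x / trig (\<lambda>n. of_real m * h t n) x = trig (qs (h t)) x"
proof -
  have nz: "trig (h t) x \<noteq> 0"
    using trig_h_pos[OF t, of x] by auto
  have "summable (\<lambda>n. norm (of_nat n * h t n))"
    using summable_h1[OF t] by (simp add: norm_mult)
  from trig_cmult[OF this, of "of_real m" x]
  have "trig (\<lambda>n. of_nat n * (of_real m * h t n)) x = of_real m * trig (\<lambda>n. of_nat n * h t n) x"
    by (simp add: ac_simps)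
  then show ?thesis
    using nz m trig_qs[OF h_0[OF t] summable_h0[OF t] summable_qs[OF t], of x, symmetric]
    by (simp add: trig_cmult[OF summable_h0[OF t]])
qed

text \<open>The series is differentiated termwise in time; \<open>maj_q c\<close> is summable and
  bounds all the time derivatives up to the factor 1/m, down to t = 0. That factor 1/m then cancels
  against the m in \<open>u\<close>.\<close>

lemma u_has_derivative:
  assumes t: "t \<ge> 0"
  shows "((\<lambda>r. u r x) has_real_derivative - Re (trig (qs (h t)) x)) (at t within {0..})"
proof -
  have "((\<lambda>r. \<Sum>n. h r n * cis (real n * x)) has_vector_derivative
      (\<Sum>n. ((- (1 / m)) *\<^sub>R qs (h t) n) * cis (real n * x))) (at t within {0..})"
  proof (rule has_vector_derivative_suminf)
    show "((\<lambda>r. h r n * cis (real n * x)) has_vector_derivative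
        ((- (1 / m)) *\<^sub>R qs (h s) n) * cis (real n * x)) (at s within {0..})" if "s \<in> {0..}" for n s
      using that by (intro has_vector_derivative_mult_left qs_solution_has_vector_derivative[OF h]) simp
    show "norm (((- (1 / m)) *\<^sub>R qs (h s) n) * cis (real n * x)) \<le> 1 / m * maj_q c n" if "s \<in> {0..}" for n s
      using that m qs_le[of s n] by (simp add: norm_mult divide_right_mono)
    show "summable (\<lambda>n. 1 / m * maj_q c n)"
      by (rule summable_mult[OF summable_q])
    show "summable (\<lambda>n. h s n * cis (real n * x))" if "s \<in> {0..}" for s
      using that by (intro summable_trig summable_h0) simp
  qed (use t in auto)
  moreover have "(\<Sum>n. ((- (1 / m)) *\<^sub>R qs (h t) n) * cis (real n * x)) = (- (1 / m)) *\<^sub>R trig (qs (h t)) x"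
    unfolding trig_def using suminf_scaleR_right[OF summable_trig(1)[OF summable_qs[OF t], of x], of "- (1 / m)"]
    by simp
  ultimately have "((\<lambda>r. trig (h r) x) has_vector_derivative (- (1 / m)) *\<^sub>R trig (qs (h t)) x) (at t within {0..})"
    by (simp add: trig_def)
  from bounded_linear.has_vector_derivative[OF bounded_linear_Re this]
  have "((\<lambda>r. Re (trig (h r) x)) has_real_derivative - (1 / m) * Re (trig (qs (h t)) x)) (at t within {0..})"
    by (simp add: has_real_derivative_iff_has_vector_derivative)
  from DERIV_cmult[OF this, of m]
  have "((\<lambda>r. m * Re (trig (h r) x)) has_real_derivative - Re (trig (qs (h t)) x)) (at t within {0..})"
    using m by simp
  then show ?thesis
    by (rule has_field_derivative_transform_within[OF _ zero_less_one]) (use t u_eq in auto)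
qed

lemma positive_solution_u: "positive_solution {0..} (u 0) u"
  unfolding positive_solution_def
proof (intro conjI ballI allI)
  show "continuous_in_H2 {0..} u"
    by (rule continuous_in_H2_u)
  fix t x :: real assume "t \<in> {0..}"
  then have t: "t \<ge> 0" by simp
  show "continuous_on UNIV (u t)"
    unfolding u_def using summable_norm_of_weighted[OF summable_m(2)[OF t]]
    by (intro continuous_intros continuous_on_trig)
  show pos: "0 < u t x" for x
    using u_eq[OF t] trig_h_pos[OF t] m by simp
  have "hilbert_transform (u t) y = Im (trig (\<lambda>n. of_real m * h t n) y)" for y
    unfolding u_def[abs_def] using h_0[OF t] summable_m(2)[OF t] by (intro hilbert_transform_Re_trig) auto
  then have "((\<lambda>y. arctan (hilbert_transform (u t) y / u t y)) has_real_derivative Re (trig (qs (h t)) x)) (at x)"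
    using flux_has_derivative[OF summable_m(2)[OF t], of x] pos[of x]
    by (simp add: u_def quotient_eq[OF t])
  with u_has_derivative[OF t, of x]
  show "\<exists>d. ((\<lambda>y. arctan (hilbert_transform (u t) y / u t y)) has_real_derivative d) (at x) \<and>
      ((\<lambda>r. u r x) has_real_derivative - d) (at t within {0..})"
    by blast
qed simp

lemma wiener_norm_u:
  assumes "t \<ge> 0"
  shows "wiener_norm 1 (\<lambda>x. u t x - m) = m * (\<Sum>n. real n * norm (h t n))"
proof -
  have "wiener_norm 1 (\<lambda>x. u t x - m) = (\<Sum>n. real n * norm (of_real m * h t n))"
    using wiener_norm_Re_trig_minus_mean[OF summable_m(2)[OF assms]] h_0[OF assms] by (simp add: u_def)
  also have "\<dots> = (\<Sum>n. m * (real n * norm (h t n)))"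
    using m by (simp add: norm_mult ac_simps)
  also have "\<dots> = m * (\<Sum>n. real n * norm (h t n))"
    by (rule suminf_mult[OF summable_h1[OF assms]])
  finally show ?thesis .
qed

lemma wiener_norm_decay:
  assumes "t \<ge> 0"
  shows "wiener_norm 1 (\<lambda>x. u t x - m) \<le> wiener_norm 1 (\<lambda>x. u 0 x - m) * exp (- (1 / (2 * m)) * t)"
  unfolding wiener_norm_u[OF assms] wiener_norm_u[OF order_refl]
  using mult_left_mono[OF decay[OF assms], of m] m by (simp add: ac_simps)

end

section \<open>Uniqueness\<close>

lemma hardy_diff:
  assumes "continuous_on UNIV u" "continuous_on UNIV v"
  shows "hardy (\<lambda>x. u x - v x) n = hardy u n - hardy v n"
  by (simp add: hardy_def fourier_coeff_diff[OF assms] right_diff_distrib)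

text \<open>Bounds uniform in x: closeness of coefficients in A^1 and in the mean makes both the
  series and its derivative uniformly close.\<close>

lemma trig_dist_le:
  assumes a: "summable (\<lambda>n. real n * norm (a n))" and b: "summable (\<lambda>n. real n * norm (b n))"
  shows "norm (trig a x - trig b x) \<le> norm (a 0 - b 0) + (\<Sum>n. real n * norm (a n - b n))"
    and "norm (trig (\<lambda>n. of_nat n * a n) x - trig (\<lambda>n. of_nat n * b n) x) \<le> (\<Sum>n. real n * norm (a n - b n))"
    and "summable (\<lambda>n. real n * norm (a n - b n))"
proof -
  show d: "summable (\<lambda>n. real n * norm (a n - b n))"
  proof (rule summable_comparison_test'[OF summable_add[OF a b]])
    show "norm (real n * norm (a n - b n)) \<le> real n * norm (a n) + real n * norm (b n)" for n
      using mult_left_mono[OF norm_triangle_ineq4[of "a n" "b n"], of "real n"] by (simp add: distrib_left)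
  qed
  have d': "summable (\<lambda>n. norm (a n - b n))"
    using d by (rule summable_norm_of_weighted)
  have "norm (trig a x - trig b x) \<le> (\<Sum>n. norm (a n - b n))"
    using trig_diff[OF summable_norm_of_weighted[OF a] summable_norm_of_weighted[OF b], of x] norm_trig_le[OF d', of x]
    by simp
  also have "\<dots> = norm (a 0 - b 0) + (\<Sum>n. norm (a (Suc n) - b (Suc n)))"
    using suminf_split_head[OF d'] by simp
  also have "(\<Sum>n. norm (a (Suc n) - b (Suc n))) \<le> (\<Sum>n. real (Suc n) * norm (a (Suc n) - b (Suc n)))"
  proof (rule suminf_le)
    show "norm (a (Suc n) - b (Suc n)) \<le> real (Suc n) * norm (a (Suc n) - b (Suc n))" for n
      using mult_right_mono[of 1 "real (Suc n)" "norm (a (Suc n) - b (Suc n))"] by simp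
    show "summable (\<lambda>n. norm (a (Suc n) - b (Suc n)))"
      using d' by (subst summable_Suc_iff)
    show "summable (\<lambda>n. real (Suc n) * norm (a (Suc n) - b (Suc n)))"
      using d by (subst summable_Suc_iff)
  qed
  also have "\<dots> = (\<Sum>n. real n * norm (a n - b n))"
    using suminf_split_head[OF d] by simp
  finally show "norm (trig a x - trig b x) \<le> norm (a 0 - b 0) + (\<Sum>n. real n * norm (a n - b n))"
    by simp
  have w: "summable (\<lambda>n. norm (of_nat n * a n))" "summable (\<lambda>n. norm (of_nat n * b n))"
    "summable (\<lambda>n. norm (of_nat n * a n - of_nat n * b n))"
    using a b d by (simp_all add: norm_mult right_diff_distrib[symmetric])
  show "norm (trig (\<lambda>n. of_nat n * a n) x - trig (\<lambda>n. of_nat n * b n) x) \<le> (\<Sum>n. real n * norm (a n - b n))"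
    using trig_diff[OF w(1,2), of x] norm_trig_le[OF w(3), of x]
    by (simp add: norm_mult right_diff_distrib[symmetric])
qed

section \<open>An arbitrary positive solution in coefficient form\<close>

locale positive_sol =
  fixes T :: real and w0 :: "real \<Rightarrow> real" and w :: "real \<Rightarrow> real \<Rightarrow> real"
  assumes T: "0 < T" and sol: "positive_solution {0..T} w0 w"
begin

definition b :: "real \<Rightarrow> nat \<Rightarrow> complex" where "b t = hardy (w t)"

lemma w:
  assumes "t \<in> {0..T}"
  shows "w t \<in> sobolev 2" "continuous_on UNIV (w t)" "0 < w t x"
  using sol assms by (auto simp: positive_solution_def continuous_in_H2_def)

lemma b4: "t \<in> {0..T} \<Longrightarrow> summable (\<lambda>n. real n ^ 4 * (norm (b t n))\<^sup>2)"
  unfolding b_def by (intro sobolev_summable_hardy w)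

lemmas b1 = Cauchy_Schwarz_weighted(1)[OF b4]
lemmas b0 = summable_norm_of_weighted[OF b1]

lemma w_eq: "t \<in> {0..T} \<Longrightarrow> w t = (\<lambda>x. Re (trig (b t) x))"
  unfolding b_def by (intro sobolev_eq_Re_trig w)

lemma b_0: "b t 0 = of_real (circle_mean (w t))"
  by (simp add: b_def hardy_def fourier_coeff_0)

lemma b_0_pos: "t \<in> {0..T} \<Longrightarrow> 0 < Re (b t 0)"
  unfolding b_0 using w by (simp add: circle_mean_pos)

text \<open>The A^1 distance completed by the means. It is weak enough to be bounded by the H^2
  norms of the difference, and strong enough to control the boundary values of F and zF' uniformly
  in x.\<close>

definition dst :: "real \<Rightarrow> real \<Rightarrow> real" where
  "dst r t = norm (b r 0 - b t 0) + (\<Sum>n. real n * norm (b r n - b t n))"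

lemma dst_le:
  assumes "r \<in> {0..T}" "t \<in> {0..T}"
  shows "dst r t \<le> sobolev_norm 0 (\<lambda>x. w r x - w t x) +
    sqrt (\<Sum>n. (1 / real n)\<^sup>2) * sobolev_norm 2 (\<lambda>x. w r x - w t x)"
proof -
  define d where "d = hardy (\<lambda>x. w r x - w t x)"
  have d: "d n = b r n - b t n" for n
    unfolding d_def b_def using assms by (intro hardy_diff w)
  then have d_fun: "d = (\<lambda>n. b r n - b t n)" by (rule ext)
  have eq: "w r x - w t x = Re (trig d x)" for x
    using trig_diff[OF b0[OF assms(1)] b0[OF assms(2)], of x]
    unfolding w_eq[OF assms(1)] w_eq[OF assms(2)] d_fun by (simp flip: minus_complex.sel)
  have "(\<lambda>x. w r x - w t x) \<in> sobolev 2 \<and> summable (\<lambda>n. real n ^ 4 * (norm (d n))\<^sup>2)"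
  proof -
    have "real n ^ 4 * (norm (d n))\<^sup>2 \<le> 2 * (real n ^ 4 * (norm (b r n))\<^sup>2) + 2 * (real n ^ 4 * (norm (b t n))\<^sup>2)" for n
    proof -
      have "(norm (d n))\<^sup>2 \<le> (norm (b r n) + norm (b t n))\<^sup>2"
        unfolding d by (intro power_mono norm_triangle_ineq4) auto
      also have "\<dots> \<le> 2 * (norm (b r n))\<^sup>2 + 2 * (norm (b t n))\<^sup>2"
        using sum_squares_bound[of "norm (b r n)" "norm (b t n)"] by (simp add: power2_sum)
      finally have "real n ^ 4 * (norm (d n))\<^sup>2 \<le> real n ^ 4 * (2 * (norm (b r n))\<^sup>2 + 2 * (norm (b t n))\<^sup>2)"
        by (intro mult_left_mono) auto
      then show ?thesis by (simp add: algebra_simps)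
    qed
    then have "summable (\<lambda>n. real n ^ 4 * (norm (d n))\<^sup>2)"
      by (intro summable_comparison_test'[OF summable_add[OF summable_mult[OF b4[OF assms(1)]] summable_mult[OF b4[OF assms(2)]]]]) auto
    then show ?thesis
      using Re_trig_sobolev(1) by (simp add: eq)
  qed
  then have d4: "summable (\<lambda>n. real n ^ 4 * (norm (d n))\<^sup>2)" by simp
  have "(\<Sum>n. real n * norm (d n)) \<le> sqrt (\<Sum>n. (1 / real n)\<^sup>2) * sqrt (\<Sum>n. real n ^ 4 * (norm (d n))\<^sup>2)"
    by (rule Cauchy_Schwarz_weighted(2)[OF d4])
  also have "\<dots> \<le> sqrt (\<Sum>n. (1 / real n)\<^sup>2) * sobolev_norm 2 (\<lambda>x. w r x - w t x)"
  proof (rule mult_left_mono)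
    have "0 \<le> (\<Sum>n. real n ^ 4 * (norm (d n))\<^sup>2)"
      using d4 by (intro suminf_nonneg) auto
    then show "sqrt (\<Sum>n. real n ^ 4 * (norm (d n))\<^sup>2) \<le> sobolev_norm 2 (\<lambda>x. w r x - w t x)"
      unfolding eq Re_trig_sobolev(2)[OF d4] using pi_ge_two
      by (intro real_sqrt_le_mono) (simp add: mult_le_cancel_right1)
    have "summable (\<lambda>n. (1 / real n)\<^sup>2)"
      using inverse_power_summable[of 2, where ?'a=real] by (simp add: power_one_over inverse_eq_divide)
    then show "0 \<le> sqrt (\<Sum>n. (1 / real n)\<^sup>2)"
      by (auto intro!: suminf_nonneg)
  qed
  finally have 1: "(\<Sum>n. real n * norm (d n)) \<le> sqrt (\<Sum>n. (1 / real n)\<^sup>2) * sobolev_norm 2 (\<lambda>x. w r x - w t x)" .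
  have "norm (d 0) = sqrt ((Re (d 0))\<^sup>2)"
    by (simp add: d b_0 flip: of_real_diff)
  also have "\<dots> \<le> sobolev_norm 0 (\<lambda>x. w r x - w t x)"
    unfolding eq sobolev_norm_0_Re_trig(2)[OF d4]
  proof (rule real_sqrt_le_mono)
    have "0 \<le> (\<Sum>n. (norm (d (Suc n)))\<^sup>2)"
      using sobolev_norm_0_Re_trig(1)[OF d4] by (intro suminf_nonneg) auto
    then have "1 * (Re (d 0))\<^sup>2 \<le> (2 * pi) * ((Re (d 0))\<^sup>2 + (\<Sum>n. (norm (d (Suc n)))\<^sup>2) / 2)"
      using pi_ge_two by (intro mult_mono) auto
    then show "(Re (d 0))\<^sup>2 \<le> 2 * pi * ((Re (d 0))\<^sup>2 + (\<Sum>n. (norm (d (Suc n)))\<^sup>2) / 2)"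
      by simp
  qed
  finally show ?thesis
    using 1 by (simp add: dst_def d)
qed

lemma dst_nonneg:
  assumes "r \<in> {0..T}" "t \<in> {0..T}"
  shows "0 \<le> dst r t"
  unfolding dst_def using trig_dist_le(3)[OF b1[OF assms(1)] b1[OF assms(2)]]
  by (intro add_nonneg_nonneg suminf_nonneg) auto

lemma dst_tendsto:
  assumes t: "t \<in> {0..T}"
  shows "((\<lambda>r. dst r t) \<longlongrightarrow> 0) (at t within {0..T})"
proof (rule Lim_null_comparison)
  have "((\<lambda>r. sobolev_norm 0 (\<lambda>x. w r x - w t x)) \<longlongrightarrow> 0) (at t within {0..T})"
    "((\<lambda>r. sobolev_norm 2 (\<lambda>x. w r x - w t x)) \<longlongrightarrow> 0) (at t within {0..T})"
    using sol t by (auto simp: positive_solution_def continuous_in_H2_def)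
  then have "((\<lambda>r. sobolev_norm 0 (\<lambda>x. w r x - w t x) + sqrt (\<Sum>n. (1 / real n)\<^sup>2) * sobolev_norm 2 (\<lambda>x. w r x - w t x))
      \<longlongrightarrow> 0 + sqrt (\<Sum>n. (1 / real n)\<^sup>2) * 0) (at t within {0..T})"
    by (intro tendsto_intros)
  then show "((\<lambda>r. sobolev_norm 0 (\<lambda>x. w r x - w t x) + sqrt (\<Sum>n. (1 / real n)\<^sup>2) * sobolev_norm 2 (\<lambda>x. w r x - w t x))
      \<longlongrightarrow> 0) (at t within {0..T})"
    by simp
  show "\<forall>\<^sub>F r in at t within {0..T}. norm (dst r t) \<le>
      sobolev_norm 0 (\<lambda>x. w r x - w t x) + sqrt (\<Sum>n. (1 / real n)\<^sup>2) * sobolev_norm 2 (\<lambda>x. w r x - w t x)"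
    unfolding eventually_at_filter
    by (rule always_eventually) (use dst_le[OF _ t] dst_nonneg[OF _ t] in auto)
qed

lemma continuous_on_by_dst:
  fixes f :: "real \<Rightarrow> 'a::real_normed_vector"
  assumes "\<And>r t. r \<in> {0..T} \<Longrightarrow> t \<in> {0..T} \<Longrightarrow> norm (f r - f t) \<le> dst r t"
  shows "continuous_on {0..T} f"
  unfolding continuous_on_def
proof
  fix t assume t: "t \<in> {0..T}"
  have "((\<lambda>r. f r - f t) \<longlongrightarrow> 0) (at t within {0..T})"
  proof (rule Lim_null_comparison[OF _ dst_tendsto[OF t]])
    show "\<forall>\<^sub>F r in at t within {0..T}. norm (f r - f t) \<le> dst r t"
      unfolding eventually_at_filter by (rule always_eventually) (use assms t in auto)
  qed
  then show "(f \<longlongrightarrow> f t) (at t within {0..T})"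
    by (simp add: LIM_zero_iff)
qed

text \<open>f(r,y) - f(t,x) is split at f(t,y): the first difference is small uniformly in y by
  \<open>dst\<close>, the second by continuity in space at the fixed time t.\<close>

lemma jointly_continuous_by_dst:
  fixes f :: "real \<Rightarrow> real \<Rightarrow> complex"
  assumes le: "\<And>r t x. r \<in> {0..T} \<Longrightarrow> t \<in> {0..T} \<Longrightarrow> norm (f r x - f t x) \<le> dst r t"
    and c: "\<And>t. t \<in> {0..T} \<Longrightarrow> continuous_on UNIV (f t)"
  shows "continuous_on ({0..T} \<times> S) (\<lambda>(t, x). f t x)"
  unfolding continuous_on_def
proof
  fix z assume "z \<in> {0..T} \<times> S"
  then obtain t x where z: "z = (t, x)" and t: "t \<in> {0..T}" by auto
  let ?F = "at z within {0..T} \<times> S"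
  have fst: "filterlim fst (nhds t) ?F" and snd: "filterlim snd (nhds x) ?F"
    using tendsto_fst[OF tendsto_ident_at[of z]] tendsto_snd[OF tendsto_ident_at[of z]] z by auto
  have "((\<lambda>p. dst (fst p) t) \<longlongrightarrow> 0) ?F"
  proof -
    have "continuous_on {0..T} (\<lambda>r. dst r t)"
    proof (rule continuous_on_by_dst)
      fix r s assume rs: "r \<in> {0..T}" "s \<in> {0..T}"
      have "norm (norm (b r 0 - b t 0) - norm (b s 0 - b t 0)) \<le> norm (b r 0 - b s 0)"
        using norm_triangle_ineq3[of "b r 0 - b t 0" "b s 0 - b t 0"] by simp
      moreover have "norm ((\<Sum>n. real n * norm (b r n - b t n)) - (\<Sum>n. real n * norm (b s n - b t n))) \<le>
          (\<Sum>n. real n * norm (b r n - b s n))"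
      proof -
        note s1 = trig_dist_le(3)[OF b1[OF rs(1)] b1[OF t]] and s2 = trig_dist_le(3)[OF b1[OF rs(2)] b1[OF t]]
          and s3 = trig_dist_le(3)[OF b1[OF rs(1)] b1[OF rs(2)]]
        have le: "norm (real n * norm (b r n - b t n) - real n * norm (b s n - b t n)) \<le> real n * norm (b r n - b s n)" for n
          using mult_left_mono[OF norm_triangle_ineq3[of "b r n - b t n" "b s n - b t n"], of "real n"]
          by (simp add: right_diff_distrib[symmetric] abs_mult)
        have "(\<Sum>n. real n * norm (b r n - b t n)) - (\<Sum>n. real n * norm (b s n - b t n)) =
            (\<Sum>n. real n * norm (b r n - b t n) - real n * norm (b s n - b t n))"
          by (rule suminf_diff[OF s1 s2])
        then show ?thesis
          using norm_suminf_le[OF le s3] by simp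
      qed
      ultimately show "norm (dst r t - dst s t) \<le> dst r s"
        unfolding dst_def by simp
    qed
    then have "continuous_on ({0..T} \<times> S) (\<lambda>p. dst (fst p) t)"
      by (rule continuous_on_compose2) (auto intro!: continuous_intros)
    then have "((\<lambda>p. dst (fst p) t) \<longlongrightarrow> dst (fst z) t) ?F"
      using \<open>z \<in> {0..T} \<times> S\<close> unfolding continuous_on_def by blast
    then show ?thesis
      by (simp add: z dst_def)
  qed
  then have "((\<lambda>p. f (fst p) (snd p) - f t (snd p)) \<longlongrightarrow> 0) ?F"
  proof (rule Lim_null_comparison[rotated])
    show "\<forall>\<^sub>F p in ?F. norm (f (fst p) (snd p) - f t (snd p)) \<le> dst (fst p) t"
      unfolding eventually_at_filter by (rule always_eventually) (use le t in auto)
  qed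
  moreover have "((\<lambda>p. f t (snd p)) \<longlongrightarrow> f t x) ?F"
  proof -
    have "isCont (f t) x"
      using c[OF t] by (simp add: continuous_on_eq_continuous_at)
    then show ?thesis
      by (rule isCont_tendsto_compose[OF _ snd])
  qed
  ultimately have "((\<lambda>p. f (fst p) (snd p) - f t (snd p) + f t (snd p)) \<longlongrightarrow> 0 + f t x) ?F"
    by (rule tendsto_add)
  then show "((\<lambda>(t, x). f t x) \<longlongrightarrow> (case z of (t, x) \<Rightarrow> f t x)) ?F"
    by (simp add: z split_def)
qed

text \<open>The time derivative -Re (zF'/F) that the equation forces on the solution, as an explicit
  expression whose joint continuity can be checked.\<close>

definition rate :: "real \<Rightarrow> real \<Rightarrow> real" where
  "rate t x = - Re (trig (\<lambda>n. of_nat n * b t n) x / trig (b t) x)"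

lemma Re_trig_b_pos: "t \<in> {0..T} \<Longrightarrow> 0 < Re (trig (b t) x)"
  using w(3)[of t x] w_eq[of t] by simp

lemma w_has_derivative:
  assumes t: "t \<in> {0..T}"
  shows "((\<lambda>r. w r x) has_real_derivative rate t x) (at t within {0..T})"
proof -
  obtain d where d: "((\<lambda>y. arctan (hilbert_transform (w t) y / w t y)) has_real_derivative d) (at x)"
      "((\<lambda>r. w r x) has_real_derivative - d) (at t within {0..T})"
    using sol t unfolding positive_solution_def by blast
  have "hilbert_transform (w t) y = Im (trig (b t) y)" for y
    unfolding w_eq[OF t] by (intro hilbert_transform_Re_trig b1[OF t]) (simp add: b_0)
  then have "((\<lambda>y. arctan (Im (trig (b t) y) / Re (trig (b t) y))) has_real_derivative d) (at x)"
    using d(1) by (simp add: w_eq[OF t])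
  then have "d = - rate t x"
    using flux_has_derivative[OF b1[OF t] Re_trig_b_pos[OF t]] by (simp add: rate_def DERIV_unique)
  then show ?thesis using d(2) by simp
qed

lemma continuous_on_rate: "continuous_on ({0..T} \<times> S) (\<lambda>(t, x). rate t x)"
proof -
  have "continuous_on ({0..T} \<times> S) (\<lambda>(t, x). trig (b t) x)"
    using trig_dist_le(1)[OF b1 b1] by (intro jointly_continuous_by_dst continuous_on_trig b0) (auto simp: dst_def)
  moreover have "continuous_on ({0..T} \<times> S) (\<lambda>(t, x). trig (\<lambda>n. of_nat n * b t n) x)"
  proof (rule jointly_continuous_by_dst)
    show "norm (trig (\<lambda>n. of_nat n * b r n) x - trig (\<lambda>n. of_nat n * b t n) x) \<le> dst r t"
      if "r \<in> {0..T}" "t \<in> {0..T}" for r t x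
      using trig_dist_le(2)[OF b1[OF that(1)] b1[OF that(2)], of x] norm_ge_zero[of "b r 0 - b t 0"]
      unfolding dst_def by linarith
    show "continuous_on UNIV (trig (\<lambda>n. of_nat n * b t n))" if "t \<in> {0..T}" for t
      using b1[OF that] by (intro continuous_on_trig) (simp add: norm_mult)
  qed
  moreover have "trig (b t) x \<noteq> 0" if "t \<in> {0..T}" for t x
    using Re_trig_b_pos[OF that, of x] by auto
  ultimately show ?thesis
    unfolding rate_def split_def by (intro continuous_intros) auto
qed

text \<open>Turns the pointwise equation into one for each coefficient by differentiating under the
  integral, which the joint continuity of \<open>rate\<close> permits.\<close>

lemma fourier_coeff_has_derivative:
  assumes t: "t \<in> {0..T}"
  shows "((\<lambda>r. fourier_coeff (w r) n) has_vector_derivative fourier_coeff (rate t) n) (at t within {0..T})"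
proof -
  let ?e = "\<lambda>x. cis (- (of_int n * x))"
  have cr: "continuous_on UNIV (rate t)"
  proof -
    have "continuous_on UNIV (\<lambda>x. (\<lambda>(t, x). rate t x) (t, x))"
      by (rule continuous_on_compose2[OF continuous_on_rate[of UNIV]]) (use t in \<open>auto intro!: continuous_intros\<close>)
    then show ?thesis by simp
  qed
  have "((\<lambda>r. integral (cbox 0 (2 * pi)) (\<lambda>x. of_real (w r x) * ?e x)) has_vector_derivative
      integral (cbox 0 (2 * pi)) (\<lambda>x. of_real (rate t x) * ?e x)) (at t within {0..T})"
  proof (rule leibniz_rule_vector_derivative[OF _ _ _ t])
    show "((\<lambda>r. complex_of_real (w r x) * ?e x) has_vector_derivative of_real (rate s x) * ?e x) (at s within {0..T})"
      if "s \<in> {0..T}" for s x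
      using w_has_derivative[OF that, of x]
      by (intro has_vector_derivative_mult_left has_vector_derivative_of_real)
         (simp add: has_real_derivative_iff_has_vector_derivative)
    show "(\<lambda>x. complex_of_real (w s x) * ?e x) integrable_on cbox 0 (2 * pi)" if "s \<in> {0..T}" for s
      using continuous_on_subset[OF w(2)[OF that]]
      by (intro integrable_continuous continuous_intros) auto
    show "continuous_on ({0..T} \<times> cbox 0 (2 * pi)) (\<lambda>(s, x). of_real (rate s x) * ?e x)"
      using continuous_on_rate unfolding split_def by (intro continuous_intros) auto
  qed simp
  from has_vector_derivative_mult_right[OF this, of "1 / (2 * of_real pi)"]
  have "((\<lambda>r. fourier_coeff (w r) n) has_vector_derivative
      1 / (2 * of_real pi) * integral (cbox 0 (2 * pi)) (\<lambda>x. of_real (rate t x) * ?e x)) (at t within {0..T})"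
    by (rule has_vector_derivative_transform[OF t, rotated]) (simp add: fourier_coeff_eq_integral[OF w(2)])
  then show ?thesis
    by (simp add: fourier_coeff_eq_integral[OF cr])
qed

text \<open>After division by the mean this is the bound 1/2 under which \<open>qs\<close> is
  absolutely summable and the series stays away from 0.\<close>

definition small_at :: "real \<Rightarrow> bool" where
  "small_at t \<longleftrightarrow> (\<Sum>n. real n * norm (b t n)) \<le> Re (b t 0) / 2"

text \<open>Smallness makes the \<open>qs\<close> of the normalised coefficients absolutely
  summable, so zF'/F is their series and the coefficients of \<open>rate t\<close> can be read off.
  The normalisation uses the mean at time t itself, not yet known to be constant.\<close>

lemma b_has_derivative:
  assumes t: "t \<in> {0..T}" and small: "small_at t"
  shows "((\<lambda>r. b r n) has_vector_derivative - qs (\<lambda>k. b t k / b t 0) n) (at t within {0..T})"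
proof -
  define k where "k = (\<lambda>n. b t n / b t 0)"
  define \<beta> where "\<beta> = Re (b t 0)"
  have \<beta>: "0 < \<beta>" unfolding \<beta>_def by (rule b_0_pos[OF t])
  have bt0: "b t 0 = of_real \<beta>" by (simp add: \<beta>_def b_0)
  have bk: "b t = (\<lambda>n. of_real \<beta> * k n)"
    using \<beta> by (auto simp: k_def bt0)
  have k0: "k 0 = 1" using \<beta> by (simp add: k_def bt0)
  have nk: "real n * norm (k n) = real n * norm (b t n) / \<beta>" for n
    using \<beta> by (simp add: k_def bt0 norm_divide)
  have k1: "summable (\<lambda>n. real n * norm (k n))"
    unfolding nk by (rule summable_divide[OF b1[OF t]])
  have ksmall: "(\<Sum>n. real n * norm (k n)) \<le> 1 / 2"
    unfolding nk suminf_divide[OF b1[OF t]] using small \<beta>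
    by (simp add: small_at_def \<beta>_def[symmetric] field_simps)
  have sq: "summable (\<lambda>n. norm (qs k n))"
  proof (rule summableI_nonneg_bounded)
    fix N
    have le: "(\<Sum>n=1..<N. real n * norm (k n)) \<le> 1 / 2"
      using sum_le_suminf[OF k1, of "{1..<N}"] ksmall by simp
    have "(\<Sum>n<N. norm (qs k n)) = (\<Sum>n=1..<N. norm (qs k n))"
      by (rule sum.mono_neutral_right) (auto simp: not_le)
    also have "\<dots> \<le> 1"
      using sum_norm_qs_le[OF le] le by linarith
    finally show "(\<Sum>n<N. norm (qs k n)) \<le> 1" .
  qed simp
  have rate: "rate t x = Re (trig (\<lambda>n. - qs k n) x)" for x
  proof -
    have "trig k x \<noteq> 0"
      using Re_trig_pos[OF k0 k1 ksmall, of x] by auto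
    moreover have "trig (\<lambda>n. of_nat n * (of_real \<beta> * k n)) x = of_real \<beta> * trig (\<lambda>n. of_nat n * k n) x"
      using trig_cmult[of "\<lambda>n. of_nat n * k n" "of_real \<beta>" x] k1 by (simp add: norm_mult ac_simps)
    moreover have "trig (\<lambda>n. - qs k n) x = - trig (qs k) x"
      using trig_cmult[OF sq, of "-1" x] by simp
    ultimately show ?thesis
      unfolding rate_def bk
      using trig_qs[OF k0 summable_norm_of_weighted[OF k1] sq, of x, symmetric] \<beta>
      by (simp add: trig_cmult[OF summable_norm_of_weighted[OF k1]])
  qed
  have "hardy (rate t) n = - qs k n"
    using sq fourier_coeff_Re_trig[of "\<lambda>n. - qs k n"] by (simp add: rate[abs_def] hardy_def)
  moreover have "((\<lambda>r. b r n) has_vector_derivative hardy (rate t) n) (at t within {0..T})"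
  proof (cases "n = 0")
    case False
    then show ?thesis
      using has_vector_derivative_mult_right[OF fourier_coeff_has_derivative[OF t, of "int n"], of 2]
      by (simp add: b_def hardy_def)
  qed (use fourier_coeff_has_derivative[OF t, of 0] in \<open>simp add: b_def hardy_def\<close>)
  ultimately show ?thesis
    by (simp add: k_def)
qed

lemma continuous_on_b: "continuous_on {0..T} (\<lambda>t. b t n)"
proof (rule continuous_on_by_dst)
  fix r t assume rt: "r \<in> {0..T}" "t \<in> {0..T}"
  note s = trig_dist_le(3)[OF b1[OF rt(1)] b1[OF rt(2)]]
  show "norm (b r n - b t n) \<le> dst r t"
  proof (cases "n = 0")
    case True
    then show ?thesis
      using s by (auto simp: dst_def intro!: suminf_nonneg)
  next
    case False
    have "norm (b r n - b t n) \<le> real n * norm (b r n - b t n)"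
      using False mult_right_mono[of 1 "real n" "norm (b r n - b t n)"] by simp
    also have "\<dots> \<le> (\<Sum>n. real n * norm (b r n - b t n))"
      using sum_le_suminf[OF s, of "{n}"] by simp
    finally show ?thesis
      by (simp add: dst_def add_increasing)
  qed
qed

lemma continuous_on_A1_norm: "continuous_on {0..T} (\<lambda>t. \<Sum>n. real n * norm (b t n))"
proof (rule continuous_on_by_dst)
  fix r t assume rt: "r \<in> {0..T}" "t \<in> {0..T}"
  note s = trig_dist_le(3)[OF b1[OF rt(1)] b1[OF rt(2)]]
  have le: "norm (real n * norm (b r n) - real n * norm (b t n)) \<le> real n * norm (b r n - b t n)" for n
    using mult_left_mono[OF norm_triangle_ineq3[of "b r n" "b t n"], of "real n"]
    by (simp add: right_diff_distrib[symmetric] abs_mult)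
  have "norm ((\<Sum>n. real n * norm (b r n)) - (\<Sum>n. real n * norm (b t n))) \<le> (\<Sum>n. real n * norm (b r n - b t n))"
    unfolding suminf_diff[OF b1[OF rt(1)] b1[OF rt(2)]] by (rule norm_suminf_le[OF le s])
  then show "norm ((\<Sum>n. real n * norm (b r n)) - (\<Sum>n. real n * norm (b t n))) \<le> dst r t"
    by (simp add: dst_def add_increasing)
qed

end

section \<open>Agreement of both solutions by a continuity argument\<close>

locale two_solutions = small_solution + positive_sol +
  assumes init: "w0 = u 0"
begin

lemma w_0: "w 0 = u 0"
  using sol init by (auto simp: positive_solution_def)

lemma b_init: "b 0 n = of_real m * h 0 n"
proof -
  have s: "summable (\<lambda>n. norm (of_real m * h 0 n))"
    using summable_norm_of_weighted[OF summable_m(2)[of 0]] by simp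
  show ?thesis
    using fourier_coeff_Re_trig[OF s] h00 by (simp add: b_def hardy_def w_0 u_def[abs_def])
qed

lemma b_eq_while_small:
  assumes \<tau>: "\<tau> \<in> {0..T}" and small: "\<And>t. 0 \<le> t \<Longrightarrow> t < \<tau> \<Longrightarrow> small_at t" and t: "t \<in> {0..\<tau>}"
  shows "b t n = of_real m * h t n"
proof -
  have sub: "{0..\<tau>} \<subseteq> {0..T}" using \<tau> by auto
  have cb: "continuous_on {0..\<tau>} (\<lambda>s. b s n)" for n
    using continuous_on_b sub by (rule continuous_on_subset)
  have db: "((\<lambda>r. b r n) has_vector_derivative - qs (\<lambda>k. b s k / b s 0) n) (at s within {0..\<tau>})"
    if "0 \<le> s" "s < \<tau>" for s n
    using that \<tau> by (intro has_vector_derivative_within_subset[OF b_has_derivative sub] small) auto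
  \<comment> \<open>Index 0 comes first: \<open>qs\<close> vanishes there, so the mean is constant,
    and dividing by it gives the autonomous system with \<kappa> = 1/m.\<close>
  have b0m: "b s 0 = of_real m" if "s \<in> {0..\<tau>}" for s
  proof (rule has_derivative_zero_unique_strong_interval[of "{\<tau>}" 0 \<tau> "\<lambda>s. b s 0"])
    show "((\<lambda>s. b s 0) has_derivative (\<lambda>h. 0)) (at s within {0..\<tau>})" if "s \<in> {0..\<tau>} - {\<tau>}" for s
      using db[of s 0] that by (simp add: has_vector_derivative_def)
  qed (use cb that b_init h00 in auto)
  have "b t n / of_real m = h t n"
  proof (rule qs_solution_unique[where \<tau>=\<tau> and k="\<lambda>s n. b s n / of_real m", OF h])
    show "(\<lambda>n. b 0 n / of_real m) = h 0"
      using m by (simp add: b_init)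
    show "continuous_on {0..\<tau>} (\<lambda>s. b s n / of_real m)" for n
      using m by (intro continuous_intros cb) auto
    show "((\<lambda>s. b s n / of_real m) has_vector_derivative (- (1 / m)) *\<^sub>R qs (\<lambda>n. b s n / of_real m) n) (at s within {0..\<tau>})"
      if "0 \<le> s" "s < \<tau>" for n s
      using has_vector_derivative_mult_left[OF db[OF that, of n], of "1 / of_real m"] that
      by (simp add: b0m scaleR_conv_of_real)
  qed (use t in auto)
  then show ?thesis
    using m by (simp add: field_simps)
qed

text \<open>The constructed solution has size at most m/20, against the threshold m/2; the gap makes
  the inequality strict, as the contradiction at the first failure time requires.\<close>

lemma b_eq_small:
  assumes "t \<in> {0..T}" "\<And>n. b t n = of_real m * h t n"
  shows "(\<Sum>n. real n * norm (b t n)) < Re (b t 0) / 2"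
proof -
  have t: "t \<ge> 0" using assms by simp
  have "(\<Sum>n. real n * norm (b t n)) = (\<Sum>n. m * (real n * norm (h t n)))"
    using m by (simp add: assms(2) norm_mult ac_simps)
  also have "\<dots> = m * (\<Sum>n. real n * norm (h t n))"
    by (rule suminf_mult[OF summable_h1[OF t]])
  also have "\<dots> \<le> m * (1 / 20)"
    using m small_t[OF t] by (intro mult_left_mono) auto
  also have "\<dots> < m / 2" using m by simp
  finally show ?thesis
    by (simp add: assms(2) h_0[OF t])
qed

text \<open>At the first time at which smallness failed, \<open>w\<close> would still agree with \<open>u\<close>, whose \<open>A\<^sup>1\<close> norm is
  strictly below the threshold.\<close>

lemma always_small: "t \<in> {0..T} \<Longrightarrow> small_at t"
proof (rule ccontr)
  define g where "g = (\<lambda>t. (\<Sum>n. real n * norm (b t n)) - Re (b t 0) / 2)"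
  \<comment> \<open>Taking g >= 0, which includes equality, makes X closed. Its infimum therefore
    lies in X, while \<open>small_at\<close> holds at all earlier times.\<close>
  define X where "X = {0..T} \<inter> g -` {0..}"
  assume "t \<in> {0..T}" "\<not> small_at t"
  then have "t \<in> X"
    by (auto simp: X_def g_def small_at_def)
  then have ne: "X \<noteq> {}" by blast
  have bdd: "bdd_below X"
    by (rule bdd_belowI[of _ 0]) (auto simp: X_def)
  have "continuous_on {0..T} g"
    unfolding g_def by (intro continuous_intros continuous_on_A1_norm continuous_on_b) auto
  then have "closed X"
    unfolding X_def by (intro continuous_closed_preimage) auto
  then have Inf: "Inf X \<in> X"
    using ne bdd by (rule closed_contains_Inf[rotated 2])
  have "small_at s" if "0 \<le> s" "s < Inf X" for s
  proof -
    have "s \<notin> X" using cInf_lower[OF _ bdd, of s] that by auto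
    then show ?thesis
      using that Inf by (auto simp: X_def g_def small_at_def)
  qed
  then have "b (Inf X) n = of_real m * h (Inf X) n" for n
    using Inf by (intro b_eq_while_small[of "Inf X"]) (auto simp: X_def)
  then have "g (Inf X) < 0"
    using b_eq_small[of "Inf X"] Inf by (simp add: g_def X_def)
  then show False
    using Inf by (simp add: X_def)
qed

lemma solutions_agree:
  assumes "t \<in> {0..T}"
  shows "w t x = u t x"
proof -
  have "b t = (\<lambda>n. of_real m * h t n)"
    using b_eq_while_small[of T t] always_small assms T by (auto simp: fun_eq_iff)
  then show ?thesis
    using w_eq[OF assms] by (simp add: u_def)
qed

end

theorem theorem2:
  "\<exists>C>0. \<exists>\<delta> :: real \<Rightarrow> real. (\<forall>m>0. 0 < \<delta> m) \<and>
     (\<forall>u0 :: real \<Rightarrow> real.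
        u0 \<in> sobolev 2 \<longrightarrow> continuous_on UNIV u0 \<longrightarrow> (\<forall>x. 0 < u0 x) \<longrightarrow>
        wiener_norm 1 (\<lambda>x. u0 x - circle_mean u0) / circle_mean u0 \<le> C \<longrightarrow>
        (\<exists>u. positive_solution {0..} u0 u \<and>
             (\<forall>T>0. \<forall>w. positive_solution {0..T} u0 w \<longrightarrow> (\<forall>t\<in>{0..T}. \<forall>x. w t x = u t x)) \<and>
             (\<forall>t\<ge>0. wiener_norm 1 (\<lambda>x. u t x - circle_mean u0)
                       \<le> wiener_norm 1 (\<lambda>x. u0 x - circle_mean u0)
                          * exp (- \<delta> (circle_mean u0) * t))))"
proof (intro exI[of _ "1 / 20"] exI[of _ "\<lambda>m. 1 / (2 * m)"] conjI allI impI)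
  fix u0 :: "real \<Rightarrow> real"
  assume u0: "u0 \<in> sobolev 2" "continuous_on UNIV u0" "\<forall>x. 0 < u0 x"
    and small: "wiener_norm 1 (\<lambda>x. u0 x - circle_mean u0) / circle_mean u0 \<le> 1 / 20"
  define m where "m = circle_mean u0"
  have m: "0 < m"
    unfolding m_def using u0 by (intro circle_mean_pos) auto
  define a where "a = hardy u0"
  have a4: "summable (\<lambda>n. real n ^ 4 * (norm (a n))\<^sup>2)"
    unfolding a_def by (rule sobolev_summable_hardy[OF u0(1)])
  note a1 = Cauchy_Schwarz_weighted(1)[OF a4]
  have a0: "a 0 = of_real m"
    by (simp add: a_def hardy_def fourier_coeff_0 m_def)
  have u0_eq: "u0 = (\<lambda>x. Re (trig a x))"
    unfolding a_def by (rule sobolev_eq_Re_trig[OF u0(1,2)])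
  have "wiener_norm 1 (\<lambda>x. u0 x - m) = (\<Sum>n. real n * norm (a n))"
    using wiener_norm_Re_trig_minus_mean[OF a1] by (simp add: u0_eq a0)
  then have a_small: "(\<Sum>n. real n * norm (a n)) / m \<le> 1 / 20"
    using small by (simp add: m_def)
  \<comment> \<open>Dividing by the mean turns the scale-invariant hypothesis into the smallness of
    the weighted sum of \<open>h 0\<close>.\<close>
  obtain h where hs: "h 0 = (\<lambda>n. a n / of_real m)" "qs_solution (1 / m) h"
    by (rule qs_solution_exists)
  interpret small_solution m h
  proof
    show "h 0 0 = 1" using m by (simp add: hs(1) a0)
    show "summable (\<lambda>n. real n ^ 4 * (norm (h 0 n))\<^sup>2)"
      using summable_divide[OF a4, of "m\<^sup>2"] by (simp add: hs(1) norm_divide power_divide)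
    have "(\<lambda>n. real n * norm (h 0 n)) = (\<lambda>n. real n * norm (a n) / m)"
      using m by (simp add: hs(1) norm_divide)
    then show "(\<Sum>n. real n * norm (h 0 n)) \<le> 1 / 20"
      using a_small by (simp add: suminf_divide[OF a1])
  qed (fact m hs(2))+
  have u_0: "u 0 = u0"
    using m by (simp add: u_def[abs_def] hs(1) u0_eq)
  show "\<exists>u. positive_solution {0..} u0 u \<and>
             (\<forall>T>0. \<forall>w. positive_solution {0..T} u0 w \<longrightarrow> (\<forall>t\<in>{0..T}. \<forall>x. w t x = u t x)) \<and>
             (\<forall>t\<ge>0. wiener_norm 1 (\<lambda>x. u t x - circle_mean u0)
                       \<le> wiener_norm 1 (\<lambda>x. u0 x - circle_mean u0)
                          * exp (- (1 / (2 * circle_mean u0)) * t))"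
  proof (intro exI[of _ u] conjI allI impI ballI)
    show "positive_solution {0..} u0 u"
      using positive_solution_u by (simp add: u_0)
    show "w t x = u t x" if "0 < T" "positive_solution {0..T} u0 w" "t \<in> {0..T}" for T w t x
    proof -
      interpret two_solutions m h T u0 w
        by unfold_locales (use that u_0 in auto)
      show ?thesis
        by (rule solutions_agree[OF that(3)])
    qed
    show "wiener_norm 1 (\<lambda>x. u t x - circle_mean u0) \<le> wiener_norm 1 (\<lambda>x. u0 x - circle_mean u0)
        * exp (- (1 / (2 * circle_mean u0)) * t)" if "t \<ge> 0" for t
      unfolding m_def[symmetric] using wiener_norm_decay[OF that] by (simp only: u_0)
  qed
qed simp_all

end
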